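(* Consider the problem of minimizing $f(x)=\mathbb{E}[F(x;\omega)]$ over $x\in\mathcal{X}$, and suppose that it is variationally coherent. Suppose that: (i) $F(x;\omega)$ is continuously differentiable in $x$ for almost all $\omega\in\Omega$; (ii) there is a finite $V\ge 0$ with $\mathbb{E}[\|\nabla F(x;\omega)\|_*^2]\le V^2$ for all $x\in\mathcal{X}$; (iii) for every $p\in\mathcal{X}$ and every sequence $y_n\in\mathcal{Y}$, $\Phi(p,y_n)\to 0$ whenever $Q(y_n)\to p$. If $f$ admits a (necessarily unique) sharp minimum $x^*$, and stochastic mirror descent is run with a surjective mirror map $Q:\mathcal{Y}\to\mathcal{X}$, then its iterates $X_n$ converge to $x^*$ in a finite number of steps almost surely, i.e. $$\mathbb{P}(X_n=x^*\text{ for all sufficiently large }n)=1.$$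
   Context: $\mathcal{X}$ is a nonempty compact convex subset of a finite-dimensional real vector space $\mathcal{V}$ with norm $\|\cdot\|$; $\mathcal{Y}=\mathcal{V}^*$ is the dual space, $\langle y,x\rangle$ the duality pairing, and $\|y\|_*=\sup\{\langle y,x\rangle:\|x\|\le 1\}$ the dual norm. $(\Omega,\mathcal{F},\mathbb{P})$ is a complete probability space, $F:\mathcal{X}\times\Omega\to\mathbb{R}$ is a stochastic objective, $f(x)=\mathbb{E}[F(x;\omega)]$, and $\mathcal{X}^*=\arg\min_{\mathcal{X}} f$. Gradients are taken with respect to $x$ and are elements of $\mathcal{Y}$. Under hypotheses (i) and (ii), $f$ is continuously differentiable with $\nabla f(x)=\mathbb{E}[\nabla F(x;\omega)]$. Variational coherence: the problem is variationally coherent if $\langle\nabla f(x),x-x^*\rangle\ge 0$ for all $x\in\mathcal{X}$, $x^*\in\mathcal{X}^*$, and there exists some $x^*\in\mathcal{X}^*$ for which equality holds only if $x\in\mathcal{X}^*$. Sharp minimum: $x^*\in\mathcal{X}$ is a sharp (local) minimum of $f$ if there is $\rho>0$ such that $f(x)\ge f(x^* )+\rho\|x-x^*\|$ for all $x\in\mathcal{X}$ sufficiently close to $x^*$. Mirror map: $h:\mathcal{X}\to\mathbb{R}$ is a regularizer, i.e. continuous and $K$-strongly convex for some $K>0$: $h(\tau x+(1-\tau)x')\le\tau h(x)+(1-\tau)h(x')-\tfrac12K\tau(1-\tau)\|x'-x\|^2$ for all $x,x'\in\mathcal{X}$, $\tau\in[0,1]$. The induced mirror map is $Q:\mathcal{Y}\to\mathcal{X}$,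 $Q(y)=\arg\max_{x\in\mathcal{X}}\{\langle y,x\rangle-h(x)\}$. The Fenchel coupling is $\Phi(p,y)=h(p)+h^*(y)-\langle y,p\rangle$ for $p\in\mathcal{X}$, $y\in\mathcal{Y}$, where $h^*(y)=\max_{x\in\mathcal{X}}\{\langle y,x\rangle-h(x)\}$. Stochastic mirror descent (SMD): $X_n=Q(Y_n)$, $Y_{n+1}=Y_n-\gamma_n\nabla F(X_n;\omega_n)$, $n=1,2,\dots$, with arbitrary deterministic initialization $Y_1\in\mathcal{Y}$, $\omega_n$ i.i.d. samples distributed according to $\mathbb{P}$, and step-sizes $\gamma_n>0$ satisfying $\sum_n\gamma_n^2<\infty$ and $\sum_n\gamma_n=\infty$. *)

theory Defs
  imports "HOL-Probability.Probability"
begin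

text \<open>
  The ambient space is a type \<open>'v :: real_normed_vector\<close> (finite-dimensionality is a hypothesis,
  stated by \<open>finite_dim\<close>).  Its dual is the type \<open>'v \<Rightarrow>\<^sub>L real\<close>: the pairing
  \<open>\<langle>y, x\<rangle>\<close> is \<open>blinfun_apply y x\<close> and the dual norm is the operator norm of that type.
  The feasible region is written \<open>C\<close>.
\<close>

definition finite_dim :: "'v::real_normed_vector itself \<Rightarrow> bool" where
  "finite_dim _ \<longleftrightarrow> (\<exists>B :: 'v set. finite B \<and> span B = UNIV)"

definition minimizers :: "'v set \<Rightarrow> ('v \<Rightarrow> real) \<Rightarrow> 'v set" where
  "minimizers C f = {x. is_arg_min f (\<lambda>x. x \<in> C) x}"

text \<open>
  Functions are differentiated relative to \<open>C\<close>.  When \<open>C\<close> has empty interior the derivative at a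
  point is determined only along the directions tangent to \<open>C\<close>.  A \<open>C\<^sup>1\<close> function is therefore
  given together with a continuous gradient field; in contrast, the pairing of \<open>grad_on C f x\<close>
  with \<open>x - x'\<close> for \<open>x' \<in> C\<close> does not depend on the derivative chosen.
\<close>

definition C1_with_gradient_on ::
    "'v::real_normed_vector set \<Rightarrow> ('v \<Rightarrow> real) \<Rightarrow> ('v \<Rightarrow> 'v \<Rightarrow>\<^sub>L real) \<Rightarrow> bool" where
  "C1_with_gradient_on C \<phi> g \<longleftrightarrow>
     (\<forall>x\<in>C. (\<phi> has_derivative blinfun_apply (g x)) (at x within C)) \<and> continuous_on C g"

definition grad_on :: "'v::real_normed_vector set \<Rightarrow> ('v \<Rightarrow> real) \<Rightarrow> 'v \<Rightarrow> 'v \<Rightarrow>\<^sub>L real" where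
  "grad_on C f x = Blinfun (frechet_derivative f (at x within C))"

definition variationally_coherent :: "'v::real_normed_vector set \<Rightarrow> ('v \<Rightarrow> real) \<Rightarrow> bool" where
  "variationally_coherent C f \<longleftrightarrow>
     (\<forall>x\<in>C. \<forall>xs\<in>minimizers C f. blinfun_apply (grad_on C f x) (x - xs) \<ge> 0) \<and>
     (\<exists>xs\<in>minimizers C f. \<forall>x\<in>C.
        blinfun_apply (grad_on C f x) (x - xs) = 0 \<longrightarrow> x \<in> minimizers C f)"

definition sharp_minimum :: "'v::real_normed_vector set \<Rightarrow> ('v \<Rightarrow> real) \<Rightarrow> 'v \<Rightarrow> bool" where
  "sharp_minimum C f xs \<longleftrightarrow> xs \<in> C \<and>
     (\<exists>\<rho>>0. \<forall>\<^sub>F x in at xs within C. f x \<ge> f xs + \<rho> * norm (x - xs))"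

definition strongly_convex_on :: "real \<Rightarrow> 'v::real_normed_vector set \<Rightarrow> ('v \<Rightarrow> real) \<Rightarrow> bool" where
  "strongly_convex_on K C h \<longleftrightarrow>
     (\<forall>x\<in>C. \<forall>x'\<in>C. \<forall>\<tau>\<in>{0..1}.
        h (\<tau> *\<^sub>R x + (1 - \<tau>) *\<^sub>R x') \<le>
          \<tau> * h x + (1 - \<tau>) * h x' - 1/2 * K * \<tau> * (1 - \<tau>) * (norm (x' - x))\<^sup>2)"

definition regularizer :: "'v::real_normed_vector set \<Rightarrow> ('v \<Rightarrow> real) \<Rightarrow> bool" where
  "regularizer C h \<longleftrightarrow> continuous_on C h \<and> (\<exists>K>0. strongly_convex_on K C h)"

definition mirror_map ::
    "'v::real_normed_vector set \<Rightarrow> ('v \<Rightarrow> real) \<Rightarrow> ('v \<Rightarrow>\<^sub>L real) \<Rightarrow> 'v" where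
  "mirror_map C h y = arg_max_on (\<lambda>x. blinfun_apply y x - h x) C"

text \<open>For a compact nonempty \<open>C\<close> and a continuous \<open>h\<close> the supremum is a maximum.\<close>

definition convex_conjugate ::
    "'v::real_normed_vector set \<Rightarrow> ('v \<Rightarrow> real) \<Rightarrow> ('v \<Rightarrow>\<^sub>L real) \<Rightarrow> real" where
  "convex_conjugate C h y = (SUP x\<in>C. blinfun_apply y x - h x)"

definition fenchel_coupling ::
    "'v::real_normed_vector set \<Rightarrow> ('v \<Rightarrow> real) \<Rightarrow> 'v \<Rightarrow> ('v \<Rightarrow>\<^sub>L real) \<Rightarrow> real" where
  "fenchel_coupling C h p y = h p + convex_conjugate C h y - blinfun_apply y p"

end

theory Submission
  imports Defs
begin

text \<open>
  By variational coherence and the directional derivatives at the sharp minimum \<open>x\<^sup>*\<close>, the only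
  minimizer is \<open>x\<^sup>*\<close>, and the mean gradient satisfies \<open>\<langle>\<nabla>f(x\<^sup>*), x - x\<^sup>*\<rangle> \<ge> \<rho> \<parallel>x - x\<^sup>*\<parallel>\<close> on \<open>C\<close>.  The Fenchel
  coupling \<open>\<Phi>(x\<^sup>*, Y\<^sub>n)\<close> decreases up to a martingale difference and a summable error.  Since the
  \<open>L\<^sup>2\<close>-bounded martingale converges almost surely, the coupling converges along almost every path, and
  the drift \<open>\<langle>\<nabla>f(X\<^sub>n), X\<^sub>n - x\<^sup>*\<rangle>\<close> is summable against the step sizes.  Hence it vanishes along a
  subsequence, which then tends to \<open>x\<^sup>*\<close>; reciprocity forces the coupling, and thus \<open>X\<^sub>n - x\<^sup>*\<close>, to \<open>0\<close>.

  Once \<open>X\<^sub>n\<close> is close to \<open>x\<^sup>*\<close>, every step pushes \<open>Y\<^sub>n\<close> by at least \<open>\<gamma>\<^sub>n \<rho> / 2\<close> against each unit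
  direction pointing from \<open>x\<^sup>*\<close> into \<open>C\<close>, while the accumulated noise stays bounded.  As \<open>\<Sum> \<gamma>\<^sub>n = \<infinity>\<close>, \<open>Y\<^sub>n\<close>
  eventually lies in \<open>y\<^sup>*\<close> plus the polar of these directions, where \<open>Q(y\<^sup>*) = x\<^sup>*\<close> by
  surjectivity, and there \<open>Q\<close> takes the value \<open>x\<^sup>*\<close>.

  The type of functionals is not an instance of \<open>second_countable_topology\<close>, so measurability is
  checked on the coordinates with respect to a dual basis.
\<close>

section \<open>Finite-dimensional normed spaces\<close>

lemma span_finite_representation:
  assumes "finite B" "x \<in> span B"
  obtains a where "x = (\<Sum>b\<in>B. a b *\<^sub>R b)"
  using assms by (auto simp: span_finite)

text \<open>Induction on \<open>B\<close>. The induction hypothesis turns a convergent sequence of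
  combinations into Cauchy coordinates, so the span of the smaller set is closed and the new vector
  has positive distance \<open>\<delta>\<close> from it. This distance controls the new coordinate,
  and the triangle inequality then controls the others.\<close>

lemma independent_coordinates_bounded:
  fixes B :: "'v::real_normed_vector set"
  assumes "finite B" "independent B"
  shows "\<exists>c>0. \<forall>a. c * (\<Sum>b\<in>B. \<bar>a b\<bar>) \<le> norm (\<Sum>b\<in>B. a b *\<^sub>R b)"
  using assms
proof (induction B rule: finite_induct)
  case empty
  show ?case by (auto intro: exI[of _ 1])
next
  case (insert v B)
  from insert.prems insert.hyps have indep: "independent B" and nspan: "v \<notin> span B"
    by (auto simp: independent_insert)
  obtain c where c: "c > 0" "\<And>a. c * (\<Sum>b\<in>B. \<bar>a b\<bar>) \<le> norm (\<Sum>b\<in>B. a b *\<^sub>R b)"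
    using insert.IH[OF indep] by blast
  have "\<exists>\<delta>>0. \<forall>u\<in>span B. \<delta> \<le> norm (v - u)"
  proof (rule ccontr)
    assume neg: "\<not> ?thesis"
    have "\<exists>a. norm (v - (\<Sum>b\<in>B. a b *\<^sub>R b)) < 1 / Suc n" for n
    proof -
      have "1 / Suc n > (0::real)" by simp
      with neg obtain u where "u \<in> span B" "norm (v - u) < 1 / Suc n"
        by (meson not_le)
      thus ?thesis by (metis span_finite_representation[OF insert.hyps(1)])
    qed
    then obtain a where a: "\<And>n. norm (v - (\<Sum>b\<in>B. a n b *\<^sub>R b)) < 1 / Suc n" by metis
    have lim: "(\<lambda>n. \<Sum>b\<in>B. a n b *\<^sub>R b) \<longlonglongrightarrow> v"
    proof (rule LIMSEQ_norm_0[of "\<lambda>n. (\<Sum>b\<in>B. a n b *\<^sub>R b) - v", THEN LIM_zero_cancel])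
      fix n show "norm ((\<Sum>b\<in>B. a n b *\<^sub>R b) - v) < 1 / real (Suc n)"
        using a[of n] by (simp add: norm_minus_commute)
    qed
    have "Cauchy (\<lambda>n. a n b)" if b: "b \<in> B" for b
    proof (rule CauchyI)
      fix e :: real assume "e > 0"
      hence "c * e > 0" using c by simp
      then obtain N where N: "\<And>m n. m \<ge> N \<Longrightarrow> n \<ge> N \<Longrightarrow>
          norm ((\<Sum>b\<in>B. a m b *\<^sub>R b) - (\<Sum>b\<in>B. a n b *\<^sub>R b)) < c * e"
        using LIMSEQ_imp_Cauchy[OF lim] CauchyD by blast
      have "norm (a m b - a n b) < e" if "m \<ge> N" "n \<ge> N" for m n
      proof -
        have "c * \<bar>a m b - a n b\<bar> \<le> c * (\<Sum>b\<in>B. \<bar>a m b - a n b\<bar>)"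
          using c(1) b insert.hyps(1) by (intro mult_left_mono member_le_sum) auto
        also have "\<dots> \<le> norm (\<Sum>b\<in>B. (a m b - a n b) *\<^sub>R b)" by (rule c)
        also have "\<dots> < c * e"
          using N[OF that] by (simp add: scaleR_diff_left sum_subtractf)
        finally show ?thesis using c(1) by simp
      qed
      thus "\<exists>M. \<forall>m\<ge>M. \<forall>n\<ge>M. norm (a m b - a n b) < e" by blast
    qed
    hence "\<forall>b\<in>B. \<exists>l. (\<lambda>n. a n b) \<longlonglongrightarrow> l"
      by (meson Cauchy_convergent_iff convergent_def)
    then obtain l where l: "\<And>b. b \<in> B \<Longrightarrow> (\<lambda>n. a n b) \<longlonglongrightarrow> l b" by metis
    have "(\<lambda>n. \<Sum>b\<in>B. a n b *\<^sub>R b) \<longlonglongrightarrow> (\<Sum>b\<in>B. l b *\<^sub>R b)"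
      using l by (intro tendsto_intros) auto
    hence "v = (\<Sum>b\<in>B. l b *\<^sub>R b)" using lim LIMSEQ_unique by blast
    also have "\<dots> \<in> span B" by (intro span_sum span_scale span_base)
    finally show False using nspan by simp
  qed
  then obtain \<delta> where \<delta>: "\<delta> > 0" "\<And>u. u \<in> span B \<Longrightarrow> \<delta> \<le> norm (v - u)" by blast
  \<comment> \<open>The first summand bounds the coefficient of \<open>v\<close>. The second bounds
    the coefficients over \<open>B\<close>, once \<open>norm u\<close> is estimated through the full
    combination.\<close>
  define k where "k = 1 / \<delta> + (1 + norm v / \<delta>) / c"
  have k: "k > 0" using c \<delta> by (auto simp: k_def intro!: add_pos_nonneg)
  have "(\<Sum>b\<in>insert v B. \<bar>a b\<bar>) \<le> k * norm (\<Sum>b\<in>insert v B. a b *\<^sub>R b)" for a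
  proof -
    define u where "u = (\<Sum>b\<in>B. a b *\<^sub>R b)"
    have u: "u \<in> span B" unfolding u_def by (intro span_sum span_scale span_base)
    have av: "\<bar>a v\<bar> * \<delta> \<le> norm (a v *\<^sub>R v + u)"
    proof (cases "a v = 0")
      case False
      have "\<delta> \<le> norm (v - (- (1 / a v)) *\<^sub>R u)" using u by (intro \<delta> span_scale)
      also have "v - (- (1 / a v)) *\<^sub>R u = (1 / a v) *\<^sub>R (a v *\<^sub>R v + u)"
        using False by (simp add: algebra_simps)
      also have "norm \<dots> = norm (a v *\<^sub>R v + u) / \<bar>a v\<bar>" by simp
      finally show ?thesis using False by (simp add: field_simps)
    qed auto
    hence av': "\<bar>a v\<bar> \<le> norm (a v *\<^sub>R v + u) / \<delta>" using \<delta> by (simp add: field_simps)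
    have "c * (\<Sum>b\<in>B. \<bar>a b\<bar>) \<le> norm u" unfolding u_def by (rule c)
    also have "\<dots> \<le> norm (a v *\<^sub>R v + u) + \<bar>a v\<bar> * norm v"
      using norm_triangle_ineq4[of "a v *\<^sub>R v + u" "a v *\<^sub>R v"] by simp
    also have "\<dots> \<le> norm (a v *\<^sub>R v + u) + norm (a v *\<^sub>R v + u) / \<delta> * norm v"
      using mult_right_mono[OF av' norm_ge_zero[of v]] by simp
    finally have "(\<Sum>b\<in>B. \<bar>a b\<bar>) \<le> norm (a v *\<^sub>R v + u) * ((1 + norm v / \<delta>) / c)"
      using c(1) by (simp add: field_simps)
    with av' have "\<bar>a v\<bar> + (\<Sum>b\<in>B. \<bar>a b\<bar>) \<le> k * norm (a v *\<^sub>R v + u)"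
      by (simp add: k_def algebra_simps)
    thus ?thesis using insert.hyps by (simp add: u_def)
  qed
  hence "\<forall>a. (1 / k) * (\<Sum>b\<in>insert v B. \<bar>a b\<bar>) \<le> norm (\<Sum>b\<in>insert v B. a b *\<^sub>R b)"
    using k by (simp add: field_simps)
  moreover have "1 / k > 0" using k by simp
  ultimately show ?case by blast
qed

text \<open>A basis is extracted from the spanning set, and the coordinate bound makes its
  coordinate functionals continuous, hence members of the dual type. Indexing by \<open>nat\<close>
  lets almost sure statements about all coordinates be combined countably.\<close>

lemma finite_dim_dual_frame:
  assumes "finite_dim TYPE('v::real_normed_vector)"
  shows "\<exists>(d::nat) (b :: nat \<Rightarrow> 'v) (e :: nat \<Rightarrow> 'v \<Rightarrow>\<^sub>L real). \<forall>v. v = (\<Sum>i<d. blinfun_apply (e i) v *\<^sub>R b i)"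
proof -
  obtain B0 :: "'v set" where B0: "finite B0" "span B0 = UNIV"
    using assms by (auto simp: finite_dim_def)
  obtain B where B: "B \<subseteq> B0" "independent B" "B0 \<subseteq> span B"
    using maximal_independent_subset[of B0] by blast
  have fin: "finite B" using B B0 finite_subset by blast
  have sp: "x \<in> span B" for x
    using B(3) B0(2) span_minimal[OF B(3)] by auto
  obtain c where c: "c > 0" "\<And>a. c * (\<Sum>b\<in>B. \<bar>a b\<bar>) \<le> norm (\<Sum>b\<in>B. a b *\<^sub>R b)"
    using independent_coordinates_bounded[OF fin B(2)] by blast
  have rep: "(\<Sum>b\<in>B. representation B v b *\<^sub>R b) = v" for v
    using sum_representation_eq[OF B(2) sp fin] by simp
  have bl: "bounded_linear (\<lambda>v. representation B v b)" if "b \<in> B" for b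
  proof (rule bounded_linear_intro[where K = "1 / c"])
    fix x y :: 'v and r :: real
    show "representation B (x + y) b = representation B x b + representation B y b"
      using representation_add[OF B(2) sp sp] by simp
    show "representation B (r *\<^sub>R x) b = r *\<^sub>R representation B x b"
      using representation_scale[OF B(2) sp] by simp
    have "c * \<bar>representation B x b\<bar> \<le> c * (\<Sum>b\<in>B. \<bar>representation B x b\<bar>)"
      using c(1) that fin by (intro mult_left_mono member_le_sum) auto
    also have "\<dots> \<le> norm x" using c(2)[of "representation B x"] rep by simp
    finally show "norm (representation B x b) \<le> norm x * (1 / c)"
      using c(1) by (simp add: field_simps)
  qed
  obtain bs :: "nat \<Rightarrow> 'v" where bs: "bij_betw bs {0..<card B} B"
    using ex_bij_betw_nat_finite[OF fin] by blast
  have "v = (\<Sum>i<card B. blinfun_apply (Blinfun (\<lambda>v. representation B v (bs i))) v *\<^sub>R bs i)" for v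
  proof -
    have "v = (\<Sum>b\<in>B. representation B v b *\<^sub>R b)" using rep by simp
    also have "\<dots> = (\<Sum>i\<in>{0..<card B}. representation B v (bs i) *\<^sub>R bs i)"
      using sum.reindex_bij_betw[OF bs, of "\<lambda>b. representation B v b *\<^sub>R b"] by simp
    also have "\<dots> = (\<Sum>i<card B. blinfun_apply (Blinfun (\<lambda>v. representation B v (bs i))) v *\<^sub>R bs i)"
    proof (intro sum.cong)
      fix i assume "i \<in> {..<card B}"
      hence "bs i \<in> B" using bs by (auto simp: bij_betw_def)
      thus "representation B v (bs i) *\<^sub>R bs i =
          blinfun_apply (Blinfun (\<lambda>v. representation B v (bs i))) v *\<^sub>R bs i"
        by (simp add: bounded_linear_Blinfun_apply[OF bl])
    qed auto
    finally show ?thesis .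
  qed
  thus ?thesis by (intro exI[of _ "card B"] exI[of _ bs]
    exI[of _ "\<lambda>i. Blinfun (\<lambda>v. representation B v (bs i))"]) blast
qed

lemma dual_frame_expansion:
  fixes y :: "'v::real_normed_vector \<Rightarrow>\<^sub>L real"
  assumes "\<And>v. v = (\<Sum>i<d. blinfun_apply (e i) v *\<^sub>R b i)"
  shows "y = (\<Sum>i<d. blinfun_apply y (b i) *\<^sub>R e i)"
proof (rule blinfun_eqI)
  fix v
  have "blinfun_apply y v = blinfun_apply y (\<Sum>i<d. blinfun_apply (e i) v *\<^sub>R b i)"
    using assms[of v] by simp
  also have "\<dots> = blinfun_apply (\<Sum>i<d. blinfun_apply y (b i) *\<^sub>R e i) v"
    by (simp add: blinfun.sum_right blinfun.sum_left blinfun.scaleR_right blinfun.scaleR_left mult.commute)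
  finally show "blinfun_apply y v = blinfun_apply (\<Sum>i<d. blinfun_apply y (b i) *\<^sub>R e i) v" .
qed

section \<open>Mirror maps and the Fenchel coupling\<close>

text \<open>The maximizer is compared with the point at parameter \<open>t\<close> on the segment
  towards \<open>x\<close>. The strong convexity term carries the factor \<open>t * (1 - t)\<close>;
  dividing by \<open>t\<close> and letting \<open>t\<close> tend to 0 keeps the full constant
  \<open>K / 2\<close>.\<close>

lemma argmax_quadratic_growth:
  fixes C :: "'v::real_normed_vector set"
  assumes "convex C" "strongly_convex_on K C h" "q \<in> C" "x \<in> C"
    and max: "\<And>x'. x' \<in> C \<Longrightarrow> blinfun_apply y x' - h x' \<le> blinfun_apply y q - h q"
  shows "blinfun_apply y x - h x \<le> blinfun_apply y q - h q - K / 2 * (norm (x - q))\<^sup>2"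
proof -
  define N where "N = K / 2 * (norm (x - q))\<^sup>2"
  define A where "A = (blinfun_apply y x - h x) - (blinfun_apply y q - h q)"
  have ineq: "A \<le> - N * (1 - t)" if t: "0 < t" "t \<le> 1" for t
  proof -
    have "t *\<^sub>R x + (1 - t) *\<^sub>R q \<in> C"
      using assms(1,3,4) t by (simp add: convex_def)
    from max[OF this] have "blinfun_apply y (t *\<^sub>R x + (1 - t) *\<^sub>R q) - (blinfun_apply y q - h q)
        \<le> h (t *\<^sub>R x + (1 - t) *\<^sub>R q)" by simp
    also have "\<dots> \<le> t * h x + (1 - t) * h q - 1/2 * K * t * (1 - t) * (norm (q - x))\<^sup>2"
      using assms(2-4) t by (simp add: strongly_convex_on_def)
    finally have "t * A \<le> t * (- N * (1 - t))"
      by (simp add: A_def N_def blinfun.bilinear_simps norm_minus_commute algebra_simps)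
    thus ?thesis using t by (simp only: mult_le_cancel_left_pos)
  qed
  have "((\<lambda>t. - N * (1 - t)) \<longlongrightarrow> - N * (1 - 0)) (at_right 0)"
    by (intro tendsto_intros)
  moreover have "\<forall>\<^sub>F t in at_right 0. A \<le> - N * (1 - t)"
    using ineq by (auto simp: eventually_at_right_field intro!: exI[of _ 1])
  ultimately have "A \<le> - N * (1 - 0)"
    by (rule tendsto_lowerbound) simp
  thus ?thesis by (simp add: A_def N_def)
qed

context
  fixes C :: "'v::real_normed_vector set" and h :: "'v \<Rightarrow> real" and K :: real
  assumes compactC: "compact C" and neC: "C \<noteq> {}" and convexC: "convex C"
    and contH: "continuous_on C h" and K_pos: "K > 0" and sc: "strongly_convex_on K C h"
begin

lemma mirror_map_is_arg_max: "is_arg_max (\<lambda>x. blinfun_apply y x - h x) (\<lambda>x. x \<in> C) (mirror_map C h y)"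
proof -
  have "continuous_on C (\<lambda>x. blinfun_apply y x - h x)" using contH by (intro continuous_intros)
  from continuous_attains_sup[OF compactC neC this]
  obtain q where "is_arg_max (\<lambda>x. blinfun_apply y x - h x) (\<lambda>x. x \<in> C) q"
    by (auto simp: is_arg_max_linorder)
  thus ?thesis unfolding mirror_map_def arg_max_on_def arg_max_def by (rule someI)
qed

lemma mirror_map_in: "mirror_map C h y \<in> C"
  and mirror_map_max:
    "x \<in> C \<Longrightarrow> blinfun_apply y x - h x \<le> blinfun_apply y (mirror_map C h y) - h (mirror_map C h y)"
  using mirror_map_is_arg_max[of y] by (auto simp: is_arg_max_linorder)

lemma mirror_map_growth:
  "x \<in> C \<Longrightarrow> blinfun_apply y x - h x \<le> blinfun_apply y (mirror_map C h y) - h (mirror_map C h y)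
     - K / 2 * (norm (x - mirror_map C h y))\<^sup>2"
  by (rule argmax_quadratic_growth[OF convexC sc mirror_map_in _ mirror_map_max])

lemma convex_conjugate_eq:
  "convex_conjugate C h y = blinfun_apply y (mirror_map C h y) - h (mirror_map C h y)"
  unfolding convex_conjugate_def
  by (rule cSup_eq_maximum) (auto simp: mirror_map_in mirror_map_max)

text \<open>Quadratic growth away from the chosen maximizer forces every other maximizer to coincide
  with it.\<close>

lemma mirror_map_eqI:
  assumes "p \<in> C" "\<And>x. x \<in> C \<Longrightarrow> blinfun_apply y x - h x \<le> blinfun_apply y p - h p"
  shows "mirror_map C h y = p"
proof -
  have "K / 2 * (norm (p - mirror_map C h y))\<^sup>2 \<le> 0"
    using mirror_map_growth[OF assms(1), of y] assms(2)[OF mirror_map_in, of y] by simp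
  thus ?thesis using K_pos by (simp add: mult_le_0_iff)
qed

text \<open>Passing from \<open>y'\<close> to \<open>y\<close> raises the objective at
  \<open>p\<close> at least as much as at any other feasible point, so \<open>p\<close> stays
  optimal. A whole translated polar cone is thus mapped to \<open>p\<close>, which is what makes
  convergence in finitely many steps possible.\<close>

lemma mirror_map_eq_polar:
  assumes "mirror_map C h y' = p"
    and "\<And>x. x \<in> C \<Longrightarrow> blinfun_apply (y - y') (x - p) \<le> 0"
  shows "mirror_map C h y = p"
proof (rule mirror_map_eqI)
  show "p \<in> C" using assms(1) mirror_map_in by auto
  fix x assume x: "x \<in> C"
  show "blinfun_apply y x - h x \<le> blinfun_apply y p - h p"
    using mirror_map_max[OF x, of y'] assms(2)[OF x] assms(1)
    by (simp add: blinfun.bilinear_simps)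
qed

text \<open>Adding the growth inequalities at the two maximizers cancels \<open>h\<close> and leaves
  a strong monotonicity estimate; the operator norm bound then allows division by the
  distance.\<close>

lemma mirror_map_lipschitz:
  "K * norm (mirror_map C h y - mirror_map C h y') \<le> norm (y - y')"
proof -
  define q where "q = mirror_map C h y"
  define q' where "q' = mirror_map C h y'"
  have "K * (norm (q - q'))\<^sup>2 \<le> blinfun_apply (y - y') (q - q')"
    using mirror_map_growth[OF mirror_map_in, of y y'] mirror_map_growth[OF mirror_map_in, of y' y]
    by (simp add: q_def q'_def blinfun.bilinear_simps norm_minus_commute)
  also have "\<dots> \<le> norm (y - y') * norm (q - q')"
    using norm_blinfun[of "y - y'" "q - q'"] by simp
  finally have "norm (q - q') * (K * norm (q - q')) \<le> norm (q - q') * norm (y - y')"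
    by (simp add: power2_eq_square algebra_simps)
  hence "K * norm (q - q') \<le> norm (y - y') \<or> norm (q - q') = 0"
    by (metis less_eq_real_def mult_le_cancel_left_pos norm_ge_zero)
  thus ?thesis by (auto simp: q_def q'_def)
qed

lemma continuous_on_mirror_map: "continuous_on UNIV (mirror_map C h)"
proof (rule continuous_onI)
  fix y :: "'v \<Rightarrow>\<^sub>L real" and \<epsilon> :: real assume \<epsilon>: "\<epsilon> > 0"
  have "dist (mirror_map C h y') (mirror_map C h y) \<le> \<epsilon>" if "dist y' y < K * \<epsilon>" for y'
  proof -
    have "K * norm (mirror_map C h y' - mirror_map C h y) \<le> K * \<epsilon>"
      using mirror_map_lipschitz[of y' y] that by (simp add: dist_norm)
    thus ?thesis using K_pos by (simp add: dist_norm)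
  qed
  thus "\<exists>d>0. \<forall>x'\<in>UNIV. dist x' y < d \<longrightarrow> dist (mirror_map C h x') (mirror_map C h y) \<le> \<epsilon>"
    using \<epsilon> K_pos by (intro exI[of _ "K * \<epsilon>"]) auto
qed

text \<open>The coupling is the gap between the maximal value of the objective for \<open>y\<close>
  and its value at \<open>p\<close>, so quadratic growth applies.\<close>

lemma fenchel_coupling_ge:
  "p \<in> C \<Longrightarrow> K / 2 * (norm (mirror_map C h y - p))\<^sup>2 \<le> fenchel_coupling C h p y"
  using mirror_map_growth[of p y]
  by (simp add: fenchel_coupling_def convex_conjugate_eq norm_minus_commute)

text \<open>Moving the maximizer from \<open>q\<close> to \<open>q'\<close> loses a multiple of
  \<open>r\<close> squared in the old objective, and by Young's inequality this loss absorbs the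
  pairing of \<open>z\<close> with \<open>q' - q\<close>. With \<open>z\<close> a negative multiple
  of a gradient this is the one-step energy estimate.\<close>

lemma fenchel_coupling_step:
  "fenchel_coupling C h p (y + z)
    \<le> fenchel_coupling C h p y + blinfun_apply z (mirror_map C h y - p) + (norm z)\<^sup>2 / (2 * K)"
proof -
  define q where "q = mirror_map C h y"
  define q' where "q' = mirror_map C h (y + z)"
  define r where "r = norm (q' - q)"
  have "blinfun_apply z (q' - q) \<le> norm z * r"
    using norm_blinfun[of z "q' - q"] by (simp add: r_def)
  also have "\<dots> \<le> K / 2 * r\<^sup>2 + (norm z)\<^sup>2 / (2 * K)"
  proof -
    have "0 \<le> (K * r - norm z)\<^sup>2 / (2 * K)" using K_pos by simp
    also have "\<dots> = K / 2 * r\<^sup>2 + (norm z)\<^sup>2 / (2 * K) - norm z * r"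
      using K_pos by (simp add: power2_eq_square field_simps)
    finally show ?thesis by simp
  qed
  finally have "blinfun_apply z (q' - q) \<le> K / 2 * r\<^sup>2 + (norm z)\<^sup>2 / (2 * K)" .
  moreover have "blinfun_apply y q' - h q' \<le> blinfun_apply y q - h q - K / 2 * r\<^sup>2"
    using mirror_map_growth[OF mirror_map_in, of y "y + z"] by (simp add: q_def q'_def r_def)
  ultimately show ?thesis
    by (simp add: fenchel_coupling_def convex_conjugate_eq q_def[symmetric] q'_def[symmetric]
        blinfun.bilinear_simps)
qed

end

section \<open>Deterministic recursions\<close>

lemma sum_weighted_at_top:
  fixes g a :: "nat \<Rightarrow> real"
  assumes "\<And>n. g n > 0" "filterlim (\<lambda>n. \<Sum>k<n. g k) at_top sequentially"
    and "\<delta> > 0" "\<forall>\<^sub>F n in sequentially. \<delta> \<le> a n"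
  shows "filterlim (\<lambda>n. \<Sum>k<n. g k * a k) at_top sequentially"
proof -
  obtain N where N: "\<And>n. n \<ge> N \<Longrightarrow> \<delta> \<le> a n"
    using assms(4) by (auto simp: eventually_sequentially)
  \<comment> \<open>The offset turns the lower bound into an equality at \<open>n = N\<close>, where
    the induction starts.\<close>
  define c where "c = (\<Sum>k<N. g k * a k) - \<delta> * (\<Sum>k<N. g k)"
  have "c + \<delta> * (\<Sum>k<n. g k) \<le> (\<Sum>k<n. g k * a k)" if n: "n \<ge> N" for n
    using n
  proof (induction n rule: dec_induct)
    case (step n)
    have "\<delta> * g n \<le> g n * a n"
      using N[OF step(1)] assms(1)[of n] by (simp add: mult.commute)
    thus ?case using step by (simp add: algebra_simps)
  qed (simp add: c_def)
  moreover have "filterlim (\<lambda>n. c + \<delta> * (\<Sum>k<n. g k)) at_top sequentially"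
    using assms(2,3) by (intro filterlim_tendsto_add_at_top[OF tendsto_const]
        filterlim_tendsto_pos_mult_at_top[OF tendsto_const])
  ultimately show ?thesis
    by (elim filterlim_at_top_mono) (auto simp: eventually_sequentially)
qed

text \<open>A pathwise form of the Robbins--Siegmund theorem: \<open>d\<close> is the noise and \<open>r\<close> the second-order error.\<close>

lemma perturbed_decrease_convergent:
  fixes a v d r :: "nat \<Rightarrow> real"
  assumes a: "\<And>n. a n \<ge> 0" and v: "\<And>n. v n \<ge> 0"
    and step: "\<And>n. a (Suc n) \<le> a n - v n - d n + r n"
    and d: "convergent (\<lambda>n. \<Sum>k<n. d k)" and r: "summable r"
  shows "convergent a" "summable v"
proof -
  define e where "e n = (\<Sum>k<n. d k) - (\<Sum>k<n. r k)" for n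
  have e: "convergent e" unfolding e_def
    using d r by (intro convergent_diff) (auto simp: summable_iff_convergent)
  \<comment> \<open>Adding back the accumulated decrease and the corrected noise makes the recursion
    monotone. Only \<open>e\<close> can be negative, and it is bounded, so \<open>b\<close> is
    bounded below.\<close>
  define b where "b n = a n + (\<Sum>k<n. v k) + e n" for n
  have sv: "(\<Sum>k<n. v k) \<ge> 0" for n using v by (simp add: sum_nonneg)
  have dec: "decseq b"
    by (rule decseq_SucI) (use step in \<open>auto simp: b_def e_def add.commute\<close>, smt (verit) step)
  obtain B where B: "\<And>n. \<bar>e n\<bar> \<le> B"
    using convergent_imp_Bseq[OF e] by (auto simp: Bseq_def)
  have low: "- B \<le> b n" for n using B[of n] a[of n] sv[of n] by (simp add: b_def abs_le_iff)
  have cb: "convergent b"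
    using decseq_convergent[OF dec, of "- B"] low unfolding convergent_def by metis
  \<comment> \<open>The difference \<open>b n - e n\<close> is \<open>a n\<close> plus the partial
    sum of \<open>v\<close>; as \<open>a n\<close> is nonnegative, a bound on it bounds these
    partial sums.\<close>
  have cav: "convergent (\<lambda>n. b n - e n)" using cb e by (rule convergent_diff)
  then obtain D where D: "\<And>n. \<bar>b n - e n\<bar> \<le> D"
    using convergent_imp_Bseq[OF cav] by (auto simp: Bseq_def)
  have "(\<Sum>k<n. v k) \<le> D" for n using D[of n] a[of n] by (simp add: b_def)
  thus sumv: "summable v" using v by (intro bounded_imp_summable[of v D])
      (auto simp: lessThan_Suc_atMost[symmetric] simp del: sum.lessThan_Suc)
  have "a = (\<lambda>n. (b n - e n) - (\<Sum>k<n. v k))" by (auto simp: b_def)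
  thus "convergent a" using cav sumv
    by (metis (no_types) convergent_diff summable_iff_convergent)
qed

text \<open>Otherwise \<open>v\<close> eventually stays above \<open>\<epsilon>\<close>, and the
  weighted sums diverge together with those of \<open>g\<close>. The free \<open>N\<close> allows
  such indices to be picked arbitrarily late.\<close>

lemma summable_weighted_imp_small:
  fixes g v :: "nat \<Rightarrow> real"
  assumes "\<And>n. g n > 0" "filterlim (\<lambda>n. \<Sum>k<n. g k) at_top sequentially"
    and "summable (\<lambda>n. g n * v n)" "\<epsilon> > 0"
  shows "\<exists>n\<ge>N. v n < \<epsilon>"
proof (rule ccontr)
  assume "\<not> ?thesis"
  hence "\<forall>\<^sub>F n in sequentially. \<epsilon> \<le> v n" by (auto simp: eventually_sequentially not_less)
  from sum_weighted_at_top[OF assms(1,2,4) this]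
  have "filterlim (\<lambda>n. \<Sum>k<n. g k * v k) at_top sequentially" .
  moreover have "(\<lambda>n. \<Sum>k<n. g k * v k) \<longlonglongrightarrow> suminf (\<lambda>n. g n * v n)"
    using assms(3) by (simp add: summable_LIMSEQ)
  ultimately show False
    using not_tendsto_and_filterlim_at_infinity[of sequentially "\<lambda>n. \<Sum>k<n. g k * v k"]
      filterlim_at_top_imp_at_infinity by auto
qed

section \<open>Differentiation under the expectation\<close>

text \<open>Boundedness in \<open>L\<^sup>2\<close> gives uniform integrability, which is used here through truncation at level \<open>R\<close>.\<close>

lemma (in prob_space) expectation_tendsto_L2_bounded:
  fixes f :: "nat \<Rightarrow> 'a \<Rightarrow> real"
  assumes meas: "\<And>n. f n \<in> borel_measurable M"
    and sq: "\<And>n. integrable M (\<lambda>x. (f n x)\<^sup>2)" "\<And>n. expectation (\<lambda>x. (f n x)\<^sup>2) \<le> c"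
    and g: "integrable M g"
    and lim: "AE x in M. (\<lambda>n. f n x) \<longlonglongrightarrow> g x"
  shows "(\<lambda>n. expectation (f n)) \<longlonglongrightarrow> expectation g"
proof (rule LIMSEQ_I)
  fix \<epsilon> :: real assume \<epsilon>: "\<epsilon> > 0"
  define T :: "real \<Rightarrow> real \<Rightarrow> real" where "T R x = max (- R) (min R x)" for R x
  have T_meas [measurable]: "T R \<in> borel_measurable borel" for R unfolding T_def by measurable
  note [measurable] = meas
  have g_meas [measurable]: "g \<in> borel_measurable M" using g by auto
  have T_cont: "isCont (T R) x" for R x unfolding T_def by (intro continuous_intros)
  have T_bound: "\<bar>T R x\<bar> \<le> R" if "R \<ge> 0" for R x using that by (auto simp: T_def)
  have T_int: "integrable M (\<lambda>x. T R (u x))" if "R \<ge> 0" "u \<in> borel_measurable M" for R u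
    by (rule integrable_const_bound[where B = R]) (use that T_bound in auto)
  \<comment> \<open>Truncation changes only values beyond \<open>R\<close>, where the factor
    \<open>\<bar>x\<bar> / R\<close> exceeds 1. The second-moment bound thus gives an error
    \<open>c / R\<close> that is uniform in \<open>n\<close>.\<close>
  have T_err: "\<bar>x - T R x\<bar> \<le> x\<^sup>2 / R" if "R > 0" for R x
  proof (cases "\<bar>x\<bar> \<le> R")
    case True
    thus ?thesis using that by (auto simp: T_def)
  next
    case False
    have "\<bar>x - T R x\<bar> \<le> \<bar>x\<bar>" using False that by (auto simp: T_def)
    also have "\<bar>x\<bar> * R \<le> \<bar>x\<bar> * \<bar>x\<bar>" using False by (intro mult_left_mono) auto
    hence "\<bar>x\<bar> \<le> x\<^sup>2 / R" using that by (simp add: field_simps power2_eq_square)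
    finally show ?thesis .
  qed
  have f_int: "integrable M (f n)" for n
    using square_integrable_imp_integrable[OF meas sq(1)] .
  have "(\<lambda>m. expectation (\<lambda>x. T (real m) (g x))) \<longlonglongrightarrow> expectation g"
  proof (rule integral_dominated_convergence[where w = "\<lambda>x. \<bar>g x\<bar>"])
    show "AE x in M. (\<lambda>m. T (real m) (g x)) \<longlonglongrightarrow> g x"
    proof (rule AE_I2)
      fix x
      obtain N :: nat where N: "\<bar>g x\<bar> \<le> real N" using real_arch_simple by blast
      have "\<forall>\<^sub>F m in sequentially. T (real m) (g x) = g x"
        using N by (auto simp: eventually_sequentially T_def intro!: exI[of _ N])
      thus "(\<lambda>m. T (real m) (g x)) \<longlonglongrightarrow> g x" by (rule tendsto_eventually)
    qed
    show "AE x in M. norm (T (real m) (g x)) \<le> \<bar>g x\<bar>" for m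
      by (auto simp: T_def)
  qed (use g in auto)
  moreover have "(\<lambda>m. c / real m) \<longlonglongrightarrow> 0" by (rule lim_const_over_n)
  \<comment> \<open>The level is fixed first, so that truncation costs less than a third of
    \<open>\<epsilon>\<close> for the limit and for all \<open>f n\<close> at once. Dominated
    convergence at this level provides the last third.\<close>
  ultimately have "\<forall>\<^sub>F m in sequentially.
      dist (expectation (\<lambda>x. T (real m) (g x))) (expectation g) < \<epsilon> / 3 \<and>
      dist (c / real m) 0 < \<epsilon> / 3 \<and> m > 0"
    using \<epsilon> by (intro eventually_conj eventually_gt_at_top) (auto simp only: tendstoD divide_pos_pos zero_less_numeral)
  then obtain m where m: "dist (expectation (\<lambda>x. T (real m) (g x))) (expectation g) < \<epsilon> / 3"
      "dist (c / real m) 0 < \<epsilon> / 3" "m > 0"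
    by (auto simp: eventually_sequentially)
  define R where "R = real m"
  have R: "R > 0" using m by (simp add: R_def)
  have f_err: "\<bar>expectation (f n) - expectation (\<lambda>x. T R (f n x))\<bar> < \<epsilon> / 3" for n
  proof -
    have "\<bar>expectation (f n) - expectation (\<lambda>x. T R (f n x))\<bar>
        = \<bar>expectation (\<lambda>x. f n x - T R (f n x))\<bar>"
      using f_int T_int R by (subst Bochner_Integration.integral_diff) auto
    also have "\<dots> \<le> expectation (\<lambda>x. \<bar>f n x - T R (f n x)\<bar>)" by (rule integral_abs_bound)
    also have "\<dots> \<le> expectation (\<lambda>x. (f n x)\<^sup>2 / R)"
      using T_err[OF R] f_int T_int R sq(1) by (intro integral_mono) auto
    also have "\<dots> \<le> c / R" using sq(2) R by (simp add: divide_right_mono)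
    also have "c / R \<le> dist (c / real m) 0" unfolding R_def dist_real_def by linarith
    also note m(2)
    finally show ?thesis .
  qed
  have "(\<lambda>n. expectation (\<lambda>x. T R (f n x))) \<longlonglongrightarrow> expectation (\<lambda>x. T R (g x))"
  proof (rule integral_dominated_convergence[where w = "\<lambda>_. R"])
    show "AE x in M. (\<lambda>n. T R (f n x)) \<longlonglongrightarrow> T R (g x)"
      using lim by eventually_elim (rule isCont_tendsto_compose[OF T_cont])
    show "AE x in M. norm (T R (f n x)) \<le> R" for n
      using T_bound R by auto
  qed auto
  then obtain N where N: "\<And>n. n \<ge> N \<Longrightarrow>
      norm (expectation (\<lambda>x. T R (f n x)) - expectation (\<lambda>x. T R (g x))) < \<epsilon> / 3"
    using LIMSEQ_D[of _ _ "\<epsilon> / 3"] \<epsilon> by (metis divide_pos_pos zero_less_numeral)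
  have "norm (expectation (f n) - expectation g) < \<epsilon>" if "n \<ge> N" for n
    using N[OF that] f_err[of n] m(1) unfolding R_def dist_real_def real_norm_def by linarith
  thus "\<exists>N. \<forall>n\<ge>N. norm (expectation (f n) - expectation g) < \<epsilon>" by blast
qed

lemma has_derivative_along_segment:
  fixes f :: "'v::real_normed_vector \<Rightarrow> real"
  assumes "convex C" "x \<in> C" "x' \<in> C" "t \<in> {0..1}"
    and D: "(f has_derivative D) (at (x + t *\<^sub>R (x' - x)) within C)"
  shows "((\<lambda>t. f (x + t *\<^sub>R (x' - x))) has_real_derivative D (x' - x)) (at t within {0..1})"
proof -
  have sub: "(\<lambda>t. x + t *\<^sub>R (x' - x)) ` {0..1} \<subseteq> C"
  proof safe
    fix s :: real assume "s \<in> {0..1}"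
    hence "(1 - s) *\<^sub>R x + s *\<^sub>R x' \<in> C" using assms(1-3) by (simp add: convex_alt)
    thus "x + s *\<^sub>R (x' - x) \<in> C" by (simp add: algebra_simps)
  qed
  have "((\<lambda>t. x + t *\<^sub>R (x' - x)) has_derivative (\<lambda>s. s *\<^sub>R (x' - x))) (at t within {0..1})"
    by (auto intro!: derivative_eq_intros)
  from has_derivative_in_compose[OF this has_derivative_subset[OF D sub]]
  have "((\<lambda>t. f (x + t *\<^sub>R (x' - x))) has_derivative (\<lambda>s. D (s *\<^sub>R (x' - x)))) (at t within {0..1})"
    by (simp add: o_def)
  moreover have "D (s *\<^sub>R (x' - x)) = D (x' - x) * s" for s
    using D by (simp add: has_derivative_def linear_cmul bounded_linear.linear linear_scale)
  ultimately show ?thesis by (simp add: has_field_derivative_def)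
qed

lemma directional_derivative_within:
  fixes f :: "'v::real_normed_vector \<Rightarrow> real"
  assumes "convex C" "x \<in> C" "x' \<in> C" "(f has_derivative D) (at x within C)"
  shows "((\<lambda>t. (f (x + t *\<^sub>R (x' - x)) - f x) / t) \<longlongrightarrow> D (x' - x)) (at_right 0)"
  using has_derivative_along_segment[of C x x' 0 f D] assms
  by (simp add: has_field_derivative_iff at_within_Icc_at_right)

text \<open>By the mean value theorem each increment of \<open>\<phi>\<close> is a value of
  \<open>\<psi>\<close> at an intermediate point, which uniform continuity compares with the left
  endpoint. Finite sums in place of an integral let expectations be taken term by term
  later.\<close>

lemma left_Riemann_sums_tendsto:
  fixes \<phi> \<psi> :: "real \<Rightarrow> real"
  assumes der: "\<And>t. t \<in> {0..1} \<Longrightarrow> (\<phi> has_real_derivative \<psi> t) (at t within {0..1})"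
    and cont: "continuous_on {0..1} \<psi>"
  shows "(\<lambda>n. (\<Sum>k<Suc n. \<psi> (real k / real (Suc n))) / real (Suc n)) \<longlonglongrightarrow> \<phi> 1 - \<phi> 0"
proof (rule LIMSEQ_I)
  fix \<epsilon> :: real assume \<epsilon>: "\<epsilon> > 0"
  have "uniformly_continuous_on {0..1} \<psi>"
    using cont by (intro compact_uniformly_continuous) auto
  then obtain \<delta> where \<delta>: "\<delta> > 0" "\<And>s t. s \<in> {0..1} \<Longrightarrow> t \<in> {0..1} \<Longrightarrow> dist s t < \<delta> \<Longrightarrow>
      dist (\<psi> s) (\<psi> t) < \<epsilon> / 2"
    using \<epsilon> unfolding uniformly_continuous_on_def by (metis half_gt_zero)
  obtain M :: nat where M: "1 / \<delta> < real M" using reals_Archimedean2 by blast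
  have "norm ((\<Sum>k<Suc n. \<psi> (real k / real (Suc n))) / real (Suc n) - (\<phi> 1 - \<phi> 0)) < \<epsilon>"
    if n: "n \<ge> M" for n
  proof -
    define N where "N = real (Suc n)"
    have N: "N > 0" "1 / N < \<delta>"
    proof -
      show "N > 0" by (simp add: N_def)
      have "1 / \<delta> < N" using M n by (simp add: N_def)
      thus "1 / N < \<delta>" using \<delta>(1) \<open>N > 0\<close> by (simp add: field_simps)
    qed
    have step: "\<bar>\<psi> (real k / N) / N - (\<phi> (real (Suc k) / N) - \<phi> (real k / N))\<bar> \<le> \<epsilon> / 2 / N"
      if k: "k < Suc n" for k
    proof -
      define a where "a = real k / N"
      define b where "b = real (Suc k) / N"
      have ab: "0 \<le> a" "a < b" "b \<le> 1" "b - a = 1 / N"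
        using k N by (auto simp: a_def b_def N_def field_simps)
      have "\<exists>\<theta>\<in>{a<..<b}. \<phi> b - \<phi> a = (b - a) * \<psi> \<theta>"
      proof -
        have "\<exists>\<theta>\<in>{a<..<b}. \<phi> b - \<phi> a = (\<lambda>h. h * \<psi> \<theta>) (b - a)"
        proof (rule mvt_simple[OF ab(2)])
          fix t assume "a \<le> t" "t \<le> b"
          hence "(\<phi> has_real_derivative \<psi> t) (at t within {a..b})"
            using ab by (intro DERIV_subset[OF der]) auto
          thus "(\<phi> has_derivative (\<lambda>h. h * \<psi> t)) (at t within {a..b})"
            by (simp add: has_field_derivative_def mult_commute_abs)
        qed
        thus ?thesis by simp
      qed
      then obtain \<theta> where \<theta>: "\<theta> \<in> {a<..<b}" "\<phi> b - \<phi> a = (b - a) * \<psi> \<theta>" by blast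
      have "dist (\<psi> a) (\<psi> \<theta>) < \<epsilon> / 2"
        using \<theta>(1) ab N by (intro \<delta>(2)) (auto simp: dist_real_def)
      hence "\<bar>\<psi> a - \<psi> \<theta>\<bar> / N \<le> \<epsilon> / 2 / N"
        using N by (intro divide_right_mono) (auto simp: dist_real_def)
      moreover have "\<psi> a / N - (\<phi> b - \<phi> a) = (\<psi> a - \<psi> \<theta>) / N"
        using \<theta>(2) ab(4) by (simp add: diff_divide_distrib)
      ultimately show ?thesis using N by (simp add: a_def b_def)
    qed
    have "(\<Sum>k<Suc n. \<phi> (real (Suc k) / N) - \<phi> (real k / N)) = \<phi> (real (Suc n) / N) - \<phi> (real 0 / N)"
      by (rule sum_lessThan_telescope)
    hence "(\<Sum>k<Suc n. \<psi> (real k / N)) / N - (\<phi> 1 - \<phi> 0)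
        = (\<Sum>k<Suc n. \<psi> (real k / N) / N - (\<phi> (real (Suc k) / N) - \<phi> (real k / N)))"
      using N(1) by (simp only: sum_subtractf sum_divide_distrib) (simp add: N_def)
    also have "\<bar>\<dots>\<bar> \<le> (\<Sum>k<Suc n. \<epsilon> / 2 / N)"
      using step by (intro order_trans[OF sum_abs] sum_mono) auto
    also have "\<dots> = N * (\<epsilon> / 2 / N)" by (simp only: sum_constant card_lessThan N_def)
    also have "\<dots> = \<epsilon> / 2" using N(1) by simp
    finally show ?thesis using \<epsilon> by (simp add: N_def)
  qed
  thus "\<exists>M. \<forall>n\<ge>M. norm ((\<Sum>k<Suc n. \<psi> (real k / real (Suc n))) / real (Suc n) - (\<phi> 1 - \<phi> 0)) < \<epsilon>"
    by blast
qed

section \<open>The mean gradient and differentiability of the expected objective\<close>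

locale stochastic_objective = P: prob_space P
  for P :: "'w measure" +
  fixes C :: "'v::real_normed_vector set"
    and F :: "'v \<Rightarrow> 'w \<Rightarrow> real"
    and gradF :: "'v \<Rightarrow> 'w \<Rightarrow> ('v \<Rightarrow>\<^sub>L real)"
    and f :: "'v \<Rightarrow> real"
    and V :: real
  assumes finite_dim: "finite_dim TYPE('v)"
    and compact: "compact C" and convex: "convex C" and nonempty: "C \<noteq> {}"
    and F_integrable: "\<And>x. x \<in> C \<Longrightarrow> integrable P (F x)"
    and f_def: "\<And>x. f x = (\<integral>w. F x w \<partial>P)"
    and gradF_measurable: "\<And>x. x \<in> C \<Longrightarrow> gradF x \<in> borel_measurable P"
    and C1: "AE w in P. C1_with_gradient_on C (\<lambda>x. F x w) (\<lambda>x. gradF x w)"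
    and square_integrable: "\<And>x. x \<in> C \<Longrightarrow> integrable P (\<lambda>w. (norm (gradF x w))\<^sup>2)"
    and square_bound: "\<And>x. x \<in> C \<Longrightarrow> (\<integral>w. (norm (gradF x w))\<^sup>2 \<partial>P) \<le> V\<^sup>2"
begin

text \<open>The expectation is taken pairing by pairing, so that only real integrals occur;
  \<open>mean_grad_apply\<close> justifies the use of \<open>Blinfun\<close>.\<close>

definition mean_grad :: "'v \<Rightarrow> 'v \<Rightarrow>\<^sub>L real" where
  "mean_grad x = Blinfun (\<lambda>v. \<integral>w. blinfun_apply (gradF x w) v \<partial>P)"

lemma gradF_apply_measurable:
  "x \<in> C \<Longrightarrow> (\<lambda>w. blinfun_apply (gradF x w) v) \<in> borel_measurable P"
  by (rule measurable_compose[OF gradF_measurable borel_measurable_continuous_onI])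
     (auto intro: continuous_intros)

lemma gradF_apply_square_le: "(blinfun_apply (gradF x w) v)\<^sup>2 \<le> (norm (gradF x w))\<^sup>2 * (norm v)\<^sup>2"
proof -
  have "(norm (blinfun_apply (gradF x w) v))\<^sup>2 \<le> (norm (gradF x w) * norm v)\<^sup>2"
    by (intro power_mono norm_blinfun) auto
  thus ?thesis by (simp add: power_mult_distrib)
qed

lemma gradF_apply_square_integrable:
  assumes "x \<in> C"
  shows "integrable P (\<lambda>w. (blinfun_apply (gradF x w) v)\<^sup>2)"
    and "(\<integral>w. (blinfun_apply (gradF x w) v)\<^sup>2 \<partial>P) \<le> V\<^sup>2 * (norm v)\<^sup>2"
proof -
  show int: "integrable P (\<lambda>w. (blinfun_apply (gradF x w) v)\<^sup>2)"
  proof (rule Bochner_Integration.integrable_bound)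
    show "integrable P (\<lambda>w. (norm (gradF x w))\<^sup>2 * (norm v)\<^sup>2)"
      using square_integrable[OF assms] by simp
  qed (use gradF_apply_measurable[OF assms] gradF_apply_square_le in auto)
  have "(\<integral>w. (blinfun_apply (gradF x w) v)\<^sup>2 \<partial>P) \<le> (\<integral>w. (norm (gradF x w))\<^sup>2 * (norm v)\<^sup>2 \<partial>P)"
    using int square_integrable[OF assms] gradF_apply_square_le by (intro integral_mono) auto
  also have "\<dots> \<le> V\<^sup>2 * (norm v)\<^sup>2"
    using square_bound[OF assms] by (simp add: mult_right_mono)
  finally show "(\<integral>w. (blinfun_apply (gradF x w) v)\<^sup>2 \<partial>P) \<le> V\<^sup>2 * (norm v)\<^sup>2" .
qed

lemma gradF_apply_integrable:
  "x \<in> C \<Longrightarrow> integrable P (\<lambda>w. blinfun_apply (gradF x w) v)"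
  by (rule P.square_integrable_imp_integrable[OF gradF_apply_measurable gradF_apply_square_integrable(1)])

lemma mean_grad_apply:
  assumes x: "x \<in> C"
  shows "blinfun_apply (mean_grad x) v = (\<integral>w. blinfun_apply (gradF x w) v \<partial>P)"
proof -
  have norm_int: "integrable P (\<lambda>w. norm (gradF x w))"
  proof (rule P.square_integrable_imp_integrable)
    show "(\<lambda>w. norm (gradF x w)) \<in> borel_measurable P"
      by (rule measurable_compose[OF gradF_measurable[OF x] borel_measurable_continuous_onI])
         (auto intro: continuous_intros)
  qed (rule square_integrable[OF x])
  have "bounded_linear (\<lambda>v. \<integral>w. blinfun_apply (gradF x w) v \<partial>P)"
  proof (rule bounded_linear_intro[where K = "\<integral>w. norm (gradF x w) \<partial>P"])
    fix v :: 'v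
    have "\<bar>\<integral>w. blinfun_apply (gradF x w) v \<partial>P\<bar> \<le> (\<integral>w. \<bar>blinfun_apply (gradF x w) v\<bar> \<partial>P)"
      by (rule integral_abs_bound)
    also have "\<dots> \<le> (\<integral>w. norm (gradF x w) * norm v \<partial>P)"
      using gradF_apply_integrable[OF x] norm_int norm_blinfun[of "gradF x w" v for w]
      by (intro integral_mono) auto
    finally show "norm (\<integral>w. blinfun_apply (gradF x w) v \<partial>P) \<le> norm v * (\<integral>w. norm (gradF x w) \<partial>P)"
      by (simp add: mult.commute)
  qed (use gradF_apply_integrable[OF x] in \<open>auto simp: blinfun.bilinear_simps\<close>)
  thus ?thesis unfolding mean_grad_def by (simp add: bounded_linear_Blinfun_apply)
qed

text \<open>The integrands converge for almost every sample by continuity of the sampled gradient;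
  the uniform second-moment bound takes the place of a common dominating function.\<close>

lemma continuous_on_mean_grad_apply: "continuous_on C (\<lambda>x. blinfun_apply (mean_grad x) v)"
  unfolding continuous_on_sequentially
proof (intro allI ballI impI, elim conjE)
  fix u :: "nat \<Rightarrow> 'v" and x assume x: "x \<in> C" and u: "\<forall>n. u n \<in> C" "u \<longlonglongrightarrow> x"
  have "(\<lambda>n. \<integral>w. blinfun_apply (gradF (u n) w) v \<partial>P) \<longlonglongrightarrow> (\<integral>w. blinfun_apply (gradF x w) v \<partial>P)"
  proof (rule P.expectation_tendsto_L2_bounded[where c = "V\<^sup>2 * (norm v)\<^sup>2"])
    show "AE w in P. (\<lambda>n. blinfun_apply (gradF (u n) w) v) \<longlonglongrightarrow> blinfun_apply (gradF x w) v"
      using C1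
    proof eventually_elim
      case (elim w)
      hence "(\<lambda>n. gradF (u n) w) \<longlonglongrightarrow> gradF x w"
        using x u by (auto simp: C1_with_gradient_on_def continuous_on_sequentially o_def)
      thus ?case by (intro tendsto_intros)
    qed
  qed (use x u gradF_apply_measurable gradF_apply_square_integrable gradF_apply_integrable in auto)
  thus "((\<lambda>x. blinfun_apply (mean_grad x) v) \<circ> u) \<longlonglongrightarrow> blinfun_apply (mean_grad x) v"
    using x u by (simp add: o_def mean_grad_apply)
qed

lemma continuous_on_mean_grad: "continuous_on C mean_grad"
proof -
  obtain d :: nat and b :: "nat \<Rightarrow> 'v" and e :: "nat \<Rightarrow> 'v \<Rightarrow>\<^sub>L real"
    where frame: "\<And>v. v = (\<Sum>i<d. blinfun_apply (e i) v *\<^sub>R b i)"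
    using finite_dim_dual_frame[OF finite_dim] by blast
  have "mean_grad x = (\<Sum>i<d. blinfun_apply (mean_grad x) (b i) *\<^sub>R e i)" for x
    by (rule dual_frame_expansion[OF frame])
  moreover have "continuous_on C (\<lambda>x. \<Sum>i<d. blinfun_apply (mean_grad x) (b i) *\<^sub>R e i)"
    by (intro continuous_intros continuous_on_mean_grad_apply)
  ultimately show ?thesis by (metis (no_types, lifting) continuous_on_cong)
qed

lemma segment_in_C:
  assumes "x \<in> C" "x' \<in> C" "t \<in> {0..1}"
  shows "x + t *\<^sub>R (x' - x) \<in> C"
proof -
  have "(1 - t) *\<^sub>R x + t *\<^sub>R x' \<in> C" using assms convex by (simp add: convex_alt)
  thus ?thesis by (simp add: algebra_simps)
qed

text \<open>For almost every sample, the Riemann sums of the sampled gradient tend to the increment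
  of \<open>F\<close>. They are bounded in mean square uniformly in the mesh, so their expectations
  converge too, and these are the Riemann sums of the mean gradient.\<close>

lemma mean_grad_Riemann_sums:
  assumes x: "x \<in> C" "x' \<in> C"
  shows "(\<lambda>n. (\<Sum>k<Suc n. blinfun_apply (mean_grad (x + (real k / real (Suc n)) *\<^sub>R (x' - x))) (x' - x))
            / real (Suc n)) \<longlonglongrightarrow> f x' - f x"
proof -
  define z where "z n k = x + (real k / real (Suc n)) *\<^sub>R (x' - x)" for n k
  have z: "z n k \<in> C" if "k < Suc n" for n k
    unfolding z_def by (rule segment_in_C[OF x]) (use that in auto)
  define G where "G n w = (\<Sum>k<Suc n. blinfun_apply (gradF (z n k) w) (x' - x)) / real (Suc n)" for n w
  define c where "c = V\<^sup>2 * (norm (x' - x))\<^sup>2"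
  have G_meas: "G n \<in> borel_measurable P" for n
    unfolding G_def using gradF_apply_measurable[OF z]
    by (intro borel_measurable_divide borel_measurable_sum) auto
  \<comment> \<open>The average of the squares dominates the square of the average \<open>G\<close>,
    and its expectation is at most \<open>c\<close> for every mesh.\<close>
  define S where "S n w = (\<Sum>k<Suc n. (blinfun_apply (gradF (z n k) w) (x' - x))\<^sup>2) / real (Suc n)" for n w
  have S_int: "integrable P (S n)" for n
    unfolding S_def using gradF_apply_square_integrable(1)[OF z]
    by (intro integrable_divide Bochner_Integration.integrable_sum) auto
  have G_sq: "(G n w)\<^sup>2 \<le> S n w" for n w
  proof -
    have "(\<Sum>k<Suc n. blinfun_apply (gradF (z n k) w) (x' - x))\<^sup>2
        \<le> (\<Sum>k<Suc n. (blinfun_apply (gradF (z n k) w) (x' - x))\<^sup>2) * real (card {..<Suc n})"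
      by (rule sum_squared_le_sum_of_squares)
    hence "(G n w)\<^sup>2 \<le> (\<Sum>k<Suc n. (blinfun_apply (gradF (z n k) w) (x' - x))\<^sup>2) * real (Suc n) / (real (Suc n))\<^sup>2"
      unfolding G_def power_divide by (intro divide_right_mono) (simp_all del: sum.lessThan_Suc)
    also have "\<dots> = S n w" by (simp add: S_def power2_eq_square del: sum.lessThan_Suc)
    finally show ?thesis .
  qed
  have G_sq_int: "integrable P (\<lambda>w. (G n w)\<^sup>2)" for n
    by (rule Bochner_Integration.integrable_bound[OF S_int[of n]])
       (use G_meas in \<open>auto intro!: order_trans[OF G_sq abs_ge_self]\<close>)
  have S_bound: "integral\<^sup>L P (S n) \<le> c" for n
  proof -
    have "integral\<^sup>L P (S n)
        = (\<Sum>k<Suc n. \<integral>w. (blinfun_apply (gradF (z n k) w) (x' - x))\<^sup>2 \<partial>P) / real (Suc n)"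
      unfolding S_def using gradF_apply_square_integrable(1)[OF z]
      by (subst integral_divide_zero, subst Bochner_Integration.integral_sum) auto
    also have "\<dots> \<le> (\<Sum>k<Suc n. c) / real (Suc n)"
      unfolding c_def using gradF_apply_square_integrable(2)[OF z]
      by (intro divide_right_mono sum_mono) auto
    also have "\<dots> = c" by (simp only: sum_constant card_lessThan) simp
    finally show ?thesis .
  qed
  have "(\<lambda>n. integral\<^sup>L P (G n)) \<longlonglongrightarrow> (\<integral>w. F x' w - F x w \<partial>P)"
  proof (rule P.expectation_tendsto_L2_bounded[OF G_meas G_sq_int])
    show "(\<integral>w. (G n w)\<^sup>2 \<partial>P) \<le> c" for n
      using integral_mono[OF G_sq_int S_int G_sq] S_bound by (rule order_trans)
    show "integrable P (\<lambda>w. F x' w - F x w)" using F_integrable x by simp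
    show "AE w in P. (\<lambda>n. G n w) \<longlonglongrightarrow> F x' w - F x w"
      using C1
    proof eventually_elim
      case (elim w)
      have "(\<lambda>n. (\<Sum>k<Suc n. blinfun_apply (gradF (x + (real k / real (Suc n)) *\<^sub>R (x' - x)) w) (x' - x))
            / real (Suc n)) \<longlonglongrightarrow> F (x + 1 *\<^sub>R (x' - x)) w - F (x + 0 *\<^sub>R (x' - x)) w"
      proof (rule left_Riemann_sums_tendsto)
        fix t :: real assume t: "t \<in> {0..1}"
        show "((\<lambda>t. F (x + t *\<^sub>R (x' - x)) w) has_real_derivative
            blinfun_apply (gradF (x + t *\<^sub>R (x' - x)) w) (x' - x)) (at t within {0..1})"
          using elim segment_in_C[OF x t] t x convex
          by (intro has_derivative_along_segment[where C = C]) (auto simp: C1_with_gradient_on_def)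
      next
        have "continuous_on {0..1} (\<lambda>t. gradF (x + t *\<^sub>R (x' - x)) w)"
          by (rule continuous_on_compose2[where s = "{0..1}" and t = C and g = "\<lambda>x. gradF x w"])
             (use elim segment_in_C[OF x] in \<open>auto simp: C1_with_gradient_on_def intro!: continuous_intros\<close>)
        thus "continuous_on {0..1} (\<lambda>t. blinfun_apply (gradF (x + t *\<^sub>R (x' - x)) w) (x' - x))"
          by (intro continuous_intros)
      qed
      thus ?case by (simp add: G_def z_def)
    qed
  qed
  moreover have "(\<integral>w. F x' w - F x w \<partial>P) = f x' - f x"
    using F_integrable x by (simp add: f_def)
  moreover have "integral\<^sup>L P (G n) = (\<Sum>k<Suc n. blinfun_apply (mean_grad (z n k)) (x' - x)) / real (Suc n)" for n
    unfolding G_def using gradF_apply_integrable[OF z] mean_grad_apply[OF z]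
    by (subst integral_divide_zero, subst Bochner_Integration.integral_sum) auto
  ultimately show ?thesis by (simp add: z_def)
qed

text \<open>The increment of \<open>f\<close> is a limit of averages of the mean gradient over
  points of the segment. Near \<open>x\<close> all these gradients are within
  \<open>\<epsilon>\<close> of the one at \<open>x\<close> by continuity, hence so are the
  averages.\<close>

lemma f_has_derivative_mean_grad:
  assumes x: "x \<in> C"
  shows "(f has_derivative blinfun_apply (mean_grad x)) (at x within C)"
  unfolding has_derivative_within_alt
proof (intro conjI allI impI)
  fix \<epsilon> :: real assume \<epsilon>: "\<epsilon> > 0"
  then obtain \<delta> where \<delta>: "\<delta> > 0" "\<And>z. z \<in> C \<Longrightarrow> dist z x < \<delta> \<Longrightarrow> dist (mean_grad z) (mean_grad x) < \<epsilon>"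
    using continuous_on_mean_grad x unfolding continuous_on_iff by metis
  have "norm (f x' - f x - blinfun_apply (mean_grad x) (x' - x)) \<le> \<epsilon> * norm (x' - x)"
    if x': "x' \<in> C" and near: "norm (x' - x) < \<delta>" for x'
  proof (rule tendsto_upperbound)
    define z where "z n k = x + (real k / real (Suc n)) *\<^sub>R (x' - x)" for n k
    show "(\<lambda>n. norm ((\<Sum>k<Suc n. blinfun_apply (mean_grad (z n k)) (x' - x)) / real (Suc n)
        - blinfun_apply (mean_grad x) (x' - x))) \<longlonglongrightarrow> norm (f x' - f x - blinfun_apply (mean_grad x) (x' - x))"
      unfolding z_def by (intro tendsto_intros mean_grad_Riemann_sums x x')
    show "\<forall>\<^sub>F n in sequentially. norm ((\<Sum>k<Suc n. blinfun_apply (mean_grad (z n k)) (x' - x)) / real (Suc n)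
        - blinfun_apply (mean_grad x) (x' - x)) \<le> \<epsilon> * norm (x' - x)"
    proof (rule always_eventually, rule allI)
      fix n
      have le: "\<bar>blinfun_apply (mean_grad (z n k)) (x' - x) - blinfun_apply (mean_grad x) (x' - x)\<bar>
          \<le> \<epsilon> * norm (x' - x)" if k: "k < Suc n" for k
      proof -
        have t: "real k / real (Suc n) \<in> {0..1}" using k by auto
        have "dist (z n k) x = (real k / real (Suc n)) * norm (x' - x)"
          by (simp add: z_def dist_norm)
        also have "\<dots> \<le> norm (x' - x)" using t by (intro mult_left_le_one_le) auto
        finally have "dist (z n k) x \<le> norm (x' - x)" .
        hence "norm (mean_grad (z n k) - mean_grad x) \<le> \<epsilon>"
          using \<delta>(2)[OF segment_in_C[OF x x' t]] near by (simp add: z_def dist_norm)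
        hence "norm (blinfun_apply (mean_grad (z n k) - mean_grad x) (x' - x)) \<le> \<epsilon> * norm (x' - x)"
          by (rule order_trans[OF norm_blinfun mult_right_mono[OF _ norm_ge_zero]])
        thus ?thesis by (simp add: blinfun.bilinear_simps)
      qed
      have "(\<Sum>k<Suc n. blinfun_apply (mean_grad (z n k)) (x' - x)) / real (Suc n)
          - blinfun_apply (mean_grad x) (x' - x)
        = (\<Sum>k<Suc n. blinfun_apply (mean_grad (z n k)) (x' - x) - blinfun_apply (mean_grad x) (x' - x))
            / real (Suc n)"
        by (simp only: sum_subtractf sum_constant card_lessThan diff_divide_distrib) simp
      moreover have "\<bar>\<Sum>k<Suc n. blinfun_apply (mean_grad (z n k)) (x' - x) - blinfun_apply (mean_grad x) (x' - x)\<bar>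
          \<le> (\<Sum>k<Suc n. \<epsilon> * norm (x' - x))"
        using le by (intro order_trans[OF sum_abs] sum_mono) auto
      hence "\<bar>\<Sum>k<Suc n. blinfun_apply (mean_grad (z n k)) (x' - x) - blinfun_apply (mean_grad x) (x' - x)\<bar>
          / real (Suc n) \<le> \<epsilon> * norm (x' - x)"
        by (simp only: sum_constant card_lessThan) (simp add: field_simps del: sum.lessThan_Suc)
      ultimately show "norm ((\<Sum>k<Suc n. blinfun_apply (mean_grad (z n k)) (x' - x)) / real (Suc n)
          - blinfun_apply (mean_grad x) (x' - x)) \<le> \<epsilon> * norm (x' - x)"
        by (simp del: sum.lessThan_Suc)
    qed
  qed simp
  thus "\<exists>d>0. \<forall>y\<in>C. norm (y - x) < d \<longrightarrow>
      norm (f y - f x - blinfun_apply (mean_grad x) (y - x)) \<le> \<epsilon> * norm (y - x)"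
    using \<delta>(1) by blast
qed (rule blinfun.bounded_linear_right)

text \<open>Two derivatives relative to \<open>C\<close> may differ as functionals, but on a
  feasible direction both equal the limit of the same one-sided difference quotients.\<close>

lemma grad_on_apply:
  assumes x: "x \<in> C" "x' \<in> C"
  shows "blinfun_apply (grad_on C f x) (x - x') = blinfun_apply (mean_grad x) (x - x')"
proof -
  have D: "(f has_derivative frechet_derivative f (at x within C)) (at x within C)"
    using f_has_derivative_mean_grad[OF x(1)] frechet_derivative_works differentiable_def by blast
  hence "blinfun_apply (grad_on C f x) = frechet_derivative f (at x within C)"
    unfolding grad_on_def by (intro bounded_linear_Blinfun_apply has_derivative_bounded_linear)
  moreover have "frechet_derivative f (at x within C) (x' - x) = blinfun_apply (mean_grad x) (x' - x)"
    using directional_derivative_within[OF convex x D]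
      directional_derivative_within[OF convex x f_has_derivative_mean_grad[OF x(1)]]
    by (rule tendsto_unique[rotated]) simp
  ultimately have "blinfun_apply (grad_on C f x) (x' - x) = blinfun_apply (mean_grad x) (x' - x)" by simp
  thus ?thesis by (simp add: blinfun.diff_right)
qed

text \<open>Sharpness is local, but the segment from \<open>xs\<close> to any feasible point comes
  arbitrarily close to \<open>xs\<close>. Dividing the bound on the segment by \<open>t\<close> and
  letting \<open>t\<close> tend to 0 yields a first-order inequality on all of
  \<open>C\<close>.\<close>

lemma sharp_minimum_mean_grad:
  assumes "sharp_minimum C f xs"
  obtains \<rho> where "\<rho> > 0" "\<And>x. x \<in> C \<Longrightarrow> \<rho> * norm (x - xs) \<le> blinfun_apply (mean_grad xs) (x - xs)"
proof -
  obtain \<rho> where \<rho>: "\<rho> > 0" "\<forall>\<^sub>F x in at xs within C. f x \<ge> f xs + \<rho> * norm (x - xs)" and xs: "xs \<in> C"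
    using assms by (auto simp: sharp_minimum_def)
  obtain \<delta> where \<delta>: "\<delta> > 0"
      "\<And>x. x \<in> C \<Longrightarrow> x \<noteq> xs \<Longrightarrow> dist x xs < \<delta> \<Longrightarrow> f x \<ge> f xs + \<rho> * norm (x - xs)"
    using \<rho>(2) by (auto simp: eventually_at)
  have "\<rho> * norm (x - xs) \<le> blinfun_apply (mean_grad xs) (x - xs)" if x: "x \<in> C" for x
  proof (rule tendsto_lowerbound[OF directional_derivative_within[OF convex xs x f_has_derivative_mean_grad[OF xs]]])
    \<comment> \<open>The bound 1 keeps the point in \<open>C\<close>, the other one keeps it within
      \<open>\<delta>\<close> of \<open>xs\<close>. The added 1 in the denominator keeps the
      threshold positive also for \<open>x = xs\<close>.\<close>
    have "\<rho> * norm (x - xs) \<le> (f (xs + t *\<^sub>R (x - xs)) - f xs) / t"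
      if t: "0 < t" "t < min 1 (\<delta> / (norm (x - xs) + 1))" for t
    proof (cases "x = xs")
      case False
      have "t * norm (x - xs) \<le> t * (norm (x - xs) + 1)" using t by simp
      also have "\<dots> < \<delta>" using t by (simp add: pos_less_divide_eq add_nonneg_pos)
      finally have "dist (xs + t *\<^sub>R (x - xs)) xs < \<delta>" using t by (simp add: dist_norm)
      moreover have "xs + t *\<^sub>R (x - xs) \<in> C" by (rule segment_in_C[OF xs x]) (use t in auto)
      moreover have "xs + t *\<^sub>R (x - xs) \<noteq> xs" using False t by simp
      ultimately have "f xs + \<rho> * norm (xs + t *\<^sub>R (x - xs) - xs) \<le> f (xs + t *\<^sub>R (x - xs))"
        using \<delta>(2) by blast
      hence "f xs + \<rho> * (t * norm (x - xs)) \<le> f (xs + t *\<^sub>R (x - xs))"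
        using t by (simp only: add_diff_cancel_left' norm_scaleR abs_of_pos)
      thus ?thesis using t by (simp add: field_simps)
    qed auto
    moreover have "min 1 (\<delta> / (norm (x - xs) + 1)) > 0" using \<delta>(1) by (simp add: add_nonneg_pos)
    ultimately show "\<forall>\<^sub>F t in at_right 0. \<rho> * norm (x - xs) \<le> (f (xs + t *\<^sub>R (x - xs)) - f xs) / t"
      unfolding eventually_at_right_field by blast
  qed simp
  with \<rho>(1) show ?thesis using that by blast
qed

text \<open>Coherence at the point \<open>xs\<close>, tested against a minimizer \<open>z\<close>,
  gives a sign that the sharp lower bound allows only for \<open>z = xs\<close>. With a single
  minimizer, the reference point in the second half of coherence must be \<open>xs\<close> as
  well.\<close>

lemma coherent_sharp_minimum:
  assumes coh: "variationally_coherent C f" and sharp: "sharp_minimum C f xs"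
  shows "minimizers C f = {xs}"
    and "\<And>x. x \<in> C \<Longrightarrow> blinfun_apply (mean_grad x) (x - xs) \<ge> 0"
    and "\<And>x. x \<in> C \<Longrightarrow> blinfun_apply (mean_grad x) (x - xs) = 0 \<Longrightarrow> x = xs"
proof -
  have xs: "xs \<in> C" using sharp by (simp add: sharp_minimum_def)
  obtain \<rho> where \<rho>: "\<rho> > 0" "\<And>x. x \<in> C \<Longrightarrow> \<rho> * norm (x - xs) \<le> blinfun_apply (mean_grad xs) (x - xs)"
    using sharp_minimum_mean_grad[OF sharp] by metis
  have sub: "z = xs" if z: "z \<in> minimizers C f" for z
  proof -
    have zC: "z \<in> C" using z by (simp add: minimizers_def is_arg_min_def)
    have "blinfun_apply (grad_on C f xs) (xs - z) \<ge> 0"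
      using coh z xs unfolding variationally_coherent_def by blast
    hence "blinfun_apply (mean_grad xs) (xs - z) \<ge> 0" using grad_on_apply[OF xs zC] by simp
    hence "\<rho> * norm (z - xs) \<le> 0" using \<rho>(2)[OF zC] by (simp add: blinfun.diff_right)
    thus ?thesis using \<rho>(1) by (simp add: mult_le_0_iff)
  qed
  obtain z where "z \<in> minimizers C f" using coh by (auto simp: variationally_coherent_def)
  with sub show m: "minimizers C f = {xs}" by auto
  show "\<And>x. x \<in> C \<Longrightarrow> blinfun_apply (mean_grad x) (x - xs) \<ge> 0"
    and "\<And>x. x \<in> C \<Longrightarrow> blinfun_apply (mean_grad x) (x - xs) = 0 \<Longrightarrow> x = xs"
    using coh grad_on_apply xs by (auto simp: variationally_coherent_def m)
qed

end

section \<open>Measurability and square-integrable martingales\<close>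

text \<open>The sequence enumerates a union of finite nets of ever finer mesh. Its values lie in
  \<open>C\<close>, so functions that are controlled only on \<open>C\<close> can be evaluated along
  it.\<close>

lemma compact_imp_dense_sequence:
  fixes C :: "'a::metric_space set"
  assumes "compact C" "C \<noteq> {}"
  obtains c :: "nat \<Rightarrow> 'a" where "\<And>n. c n \<in> C" "\<And>x \<epsilon>. x \<in> C \<Longrightarrow> \<epsilon> > 0 \<Longrightarrow> \<exists>n. dist x (c n) < \<epsilon>"
proof -
  have "\<exists>k. finite k \<and> k \<subseteq> C \<and> C \<subseteq> (\<Union>x\<in>k. ball x (1 / real (Suc n)))" for n
  proof -
    have "C \<subseteq> (\<Union>x\<in>C. ball x (1 / real (Suc n)))" by force
    from compactE_image[OF assms(1) _ this] show ?thesis by (metis open_ball)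
  qed
  then obtain k where k: "\<And>n. finite (k n)" "\<And>n. k n \<subseteq> C"
      "\<And>n. C \<subseteq> (\<Union>x\<in>k n. ball x (1 / real (Suc n)))"
    by metis
  define T where "T = (\<Union>n. k n)"
  have "k 0 \<noteq> {}" using k(3)[of 0] assms(2) by auto
  hence T: "T \<noteq> {}" "T \<subseteq> C" using k(2) by (auto simp: T_def)
  have T_countable: "countable T" unfolding T_def by (intro countable_UN countableI_type countable_finite k(1))
  show ?thesis
  proof (rule that[of "from_nat_into T"])
    show "from_nat_into T n \<in> C" for n using from_nat_into[OF T(1)] T(2) by blast
    fix x and \<epsilon> :: real assume "x \<in> C" "\<epsilon> > 0"
    then obtain n where n: "1 / real (Suc n) < \<epsilon>" using nat_approx_posE by blast
    obtain y where y: "y \<in> k n" "dist x y < 1 / real (Suc n)"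
      using k(3)[of n] \<open>x \<in> C\<close> by (auto simp: dist_commute)
    obtain j where "from_nat_into T j = y"
      using from_nat_into_surj[OF T_countable, of y] y by (auto simp: T_def)
    thus "\<exists>n. dist x (from_nat_into T n) < \<epsilon>" using y(2) n by (intro exI[of _ j]) simp
  qed
qed

text \<open>
  The function is the pointwise limit of the functions \<open>(s, w) \<mapsto> G (c (idx s)) w\<close>, with \<open>c\<close> a dense
  sequence.
\<close>

lemma Caratheodory_measurable:
  fixes G :: "'a::metric_space \<Rightarrow> 'b \<Rightarrow> real" and \<psi> :: "'c \<Rightarrow> 'a"
  assumes C: "compact C" "C \<noteq> {}"
    and meas: "\<And>x. x \<in> C \<Longrightarrow> G x \<in> borel_measurable P"
    and cont: "\<And>w. w \<in> space P \<Longrightarrow> continuous_on C (\<lambda>x. G x w)"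
    and \<psi>: "\<psi> \<in> N \<rightarrow>\<^sub>M borel" "\<And>s. s \<in> space N \<Longrightarrow> \<psi> s \<in> C"
  shows "(\<lambda>(s, w). G (\<psi> s) w) \<in> borel_measurable (N \<Otimes>\<^sub>M P)"
proof -
  obtain c where c: "\<And>n. c n \<in> C" "\<And>x \<epsilon>. x \<in> C \<Longrightarrow> \<epsilon> > 0 \<Longrightarrow> \<exists>n::nat. dist x (c n) < \<epsilon>"
    using compact_imp_dense_sequence[OF C] by metis
  have dist_meas [measurable]: "(\<lambda>s. dist (\<psi> s) (c n)) \<in> borel_measurable N" for n
    by (rule measurable_compose[OF \<psi>(1) borel_measurable_continuous_onI]) (intro continuous_intros)
  \<comment> \<open>Taking the least admissible index makes the choice measurable in
    \<open>s\<close>.\<close>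
  define idx where "idx m s = (LEAST n. dist (\<psi> s) (c n) < 1 / real (Suc m))" for m s
  have idx_meas [measurable]: "idx m \<in> N \<rightarrow>\<^sub>M count_space UNIV" for m
    unfolding idx_def by measurable
  have idx: "dist (\<psi> s) (c (idx m s)) < 1 / real (Suc m)" if "s \<in> space N" for m s
    unfolding idx_def by (rule LeastI_ex) (use c(2)[OF \<psi>(2)[OF that]] in simp)
  have "(\<lambda>p. G (\<psi> (fst p)) (snd p)) \<in> borel_measurable (N \<Otimes>\<^sub>M P)"
  proof (rule borel_measurable_LIMSEQ_real)
    fix p assume p: "p \<in> space (N \<Otimes>\<^sub>M P)"
    hence s: "fst p \<in> space N" and w: "snd p \<in> space P" by (auto simp: space_pair_measure)
    have "(\<lambda>m. c (idx m (fst p))) \<longlonglongrightarrow> \<psi> (fst p)"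
    proof (rule metric_LIMSEQ_I)
      fix r :: real assume "r > 0"
      then obtain M where M: "1 / real (Suc M) < r" using nat_approx_posE by blast
      have "dist (c (idx m (fst p))) (\<psi> (fst p)) < r" if "m \<ge> M" for m
      proof -
        have "1 / real (Suc m) \<le> 1 / real (Suc M)" using that by (simp add: frac_le)
        thus ?thesis using idx[OF s, of m] M by (simp add: dist_commute)
      qed
      thus "\<exists>no. \<forall>n\<ge>no. dist (c (idx n (fst p))) (\<psi> (fst p)) < r" by blast
    qed
    thus "(\<lambda>m. G (c (idx m (fst p))) (snd p)) \<longlonglongrightarrow> G (\<psi> (fst p)) (snd p)"
      using cont[OF w] c(1) \<psi>(2)[OF s] by (auto simp: continuous_on_sequentially o_def)
  next
    fix m
    show "(\<lambda>p. G (c (idx m (fst p))) (snd p)) \<in> borel_measurable (N \<Otimes>\<^sub>M P)"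
    proof (rule measurable_compose_countable[where f = "\<lambda>i p. G (c i) (snd p)" and g = "\<lambda>p. idx m (fst p)"])
      show "(\<lambda>p. G (c i) (snd p)) \<in> borel_measurable (N \<Otimes>\<^sub>M P)" for i
        using measurable_compose[OF measurable_snd meas[OF c(1)]] .
    qed measurable
  qed
  thus ?thesis by (simp add: case_prod_beta')
qed

section \<open>Almost sure convergence of square-integrable martingales\<close>

context prob_space
begin

text \<open>Martingale differences expressed without conditional expectations: \<open>H n\<close> is
  the history before the increment \<open>d n\<close>, earlier increments are functions of it, and
  \<open>orth\<close> makes \<open>d n\<close> orthogonal to its bounded functions.\<close>

context
  fixes d :: "nat \<Rightarrow> 'a \<Rightarrow> real" and N :: "nat \<Rightarrow> 'h measure" and H :: "nat \<Rightarrow> 'a \<Rightarrow> 'h"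
  assumes H: "\<And>n. H n \<in> M \<rightarrow>\<^sub>M N n"
    and adapted: "\<And>k n. k < n \<Longrightarrow> \<exists>\<delta>\<in>borel_measurable (N n). \<forall>s\<in>space M. d k s = \<delta> (H n s)"
    and sq_int: "\<And>n. integrable M (\<lambda>s. (d n s)\<^sup>2)"
    and orth: "\<And>n z c. z \<in> borel_measurable (N n) \<Longrightarrow> (\<And>x. \<bar>z x\<bar> \<le> c) \<Longrightarrow>
                 expectation (\<lambda>s. z (H n s) * d n s) = 0"
begin

lemma martingale_difference_measurable: "d n \<in> borel_measurable M"
proof -
  obtain \<delta> where \<delta>: "\<delta> \<in> borel_measurable (N (Suc n))" "\<And>s. s \<in> space M \<Longrightarrow> d n s = \<delta> (H (Suc n) s)"
    using adapted[of n "Suc n"] by auto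
  have "(\<lambda>s. \<delta> (H (Suc n) s)) \<in> borel_measurable M" using measurable_compose[OF H \<delta>(1)] .
  thus ?thesis by (subst measurable_cong[OF \<delta>(2)])
qed

text \<open>
  Kolmogorov's maximal inequality: \<open>T\<close> is the sequence of partial sums stopped when it leaves the
  interval from \<open>-\<epsilon>\<close> to \<open>\<epsilon>\<close>, so that the integrand in the orthogonality relation is bounded.
\<close>

lemma maximal_inequality:
  assumes \<epsilon>: "\<epsilon> > 0"
  shows "prob {s \<in> space M. \<exists>i\<le>j. \<epsilon> \<le> \<bar>\<Sum>k<i. d (m + k) s\<bar>} \<le> (\<Sum>k<j. expectation (\<lambda>s. (d (m + k) s)\<^sup>2)) / \<epsilon>\<^sup>2"
proof -
  note [measurable] = martingale_difference_measurable
  define T where "T = rec_nat (\<lambda>_. 0) (\<lambda>j Tj s. Tj s + (if \<bar>Tj s\<bar> < \<epsilon> then d (m + j) s else 0))"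
  have T0: "T 0 s = 0" and TSuc: "T (Suc j) s = T j s + (if \<bar>T j s\<bar> < \<epsilon> then d (m + j) s else 0)" for j s
    by (simp_all add: T_def)
  have T_adapted: "\<exists>t\<in>borel_measurable (N n). \<forall>s\<in>space M. T j s = t (H n s)" if "m + j \<le> n" for j n
    using that
  proof (induction j)
    case 0
    show ?case by (intro bexI[of _ "\<lambda>_. 0"]) (auto simp: T0)
  next
    case (Suc j)
    then obtain t where t [measurable]: "t \<in> borel_measurable (N n)" "\<forall>s\<in>space M. T j s = t (H n s)" by auto
    obtain \<delta> where \<delta> [measurable]: "\<delta> \<in> borel_measurable (N n)" "\<forall>s\<in>space M. d (m + j) s = \<delta> (H n s)"
      using adapted[of "m + j" n] Suc.prems by auto
    have "(\<lambda>x. t x + (if \<bar>t x\<bar> < \<epsilon> then \<delta> x else 0)) \<in> borel_measurable (N n)" by measurable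
    moreover have "\<forall>s\<in>space M. T (Suc j) s = t (H n s) + (if \<bar>t (H n s)\<bar> < \<epsilon> then \<delta> (H n s) else 0)"
      using t(2) \<delta>(2) by (simp add: TSuc)
    ultimately show ?case
      by (intro bexI[where x = "\<lambda>x. t x + (if \<bar>t x\<bar> < \<epsilon> then \<delta> x else 0)"])
  qed
  have T_meas [measurable]: "T j \<in> borel_measurable M" for j
  proof -
    obtain t where t: "t \<in> borel_measurable (N (m + j))" "\<And>s. s \<in> space M \<Longrightarrow> T j s = t (H (m + j) s)"
      using T_adapted[of j "m + j"] by auto
    have "(\<lambda>s. t (H (m + j) s)) \<in> borel_measurable M" using measurable_compose[OF H t(1)] .
    thus ?thesis by (subst measurable_cong[OF t(2)])
  qed
  define D where "D j s = (if \<bar>T j s\<bar> < \<epsilon> then d (m + j) s else 0)" for j s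
  have D_meas [measurable]: "D j \<in> borel_measurable M" for j unfolding D_def by measurable
  have D_sq: "integrable M (\<lambda>s. (D j s)\<^sup>2)" for j
    by (rule Bochner_Integration.integrable_bound[OF sq_int[of "m + j"]]) (auto simp: D_def)
  have T_sq: "integrable M (\<lambda>s. (T j s)\<^sup>2)" for j
  proof (induction j)
    case (Suc j)
    show ?case
    proof (rule Bochner_Integration.integrable_bound)
      show "integrable M (\<lambda>s. 2 * (T j s)\<^sup>2 + 2 * (D j s)\<^sup>2)" using Suc D_sq by simp
      have "(T (Suc j) s)\<^sup>2 \<le> 2 * (T j s)\<^sup>2 + 2 * (D j s)\<^sup>2" for s
        using zero_le_power2[of "T j s - D j s"] by (simp add: TSuc D_def power2_eq_square algebra_simps)
      thus "AE s in M. norm ((T (Suc j) s)\<^sup>2) \<le> norm (2 * (T j s)\<^sup>2 + 2 * (D j s)\<^sup>2)" by auto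
    qed simp
  qed (simp add: T0)
  have "expectation (\<lambda>s. (T j s)\<^sup>2) \<le> (\<Sum>k<j. expectation (\<lambda>s. (d (m + k) s)\<^sup>2))"
  proof (induction j)
    case (Suc j)
    obtain t where t [measurable]: "t \<in> borel_measurable (N (m + j))"
        and Tt: "\<And>s. s \<in> space M \<Longrightarrow> T j s = t (H (m + j) s)"
      using T_adapted[of j "m + j"] by auto
    \<comment> \<open>As long as the stopped sum still moves, it is below \<open>\<epsilon>\<close>.
      Cutting it to 0 elsewhere leaves the product with \<open>D j\<close> unchanged and yields the
      bounded factor that \<open>orth\<close> requires, so the cross term vanishes.\<close>
    define z where "z x = (if \<bar>t x\<bar> < \<epsilon> then t x else 0)" for x
    have z: "z \<in> borel_measurable (N (m + j))" "\<bar>z x\<bar> \<le> \<epsilon>" for x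
      using \<epsilon> unfolding z_def by (measurable, auto)
    have TD: "T j s * D j s = z (H (m + j) s) * d (m + j) s" if "s \<in> space M" for s
      using Tt[OF that] by (simp add: z_def D_def)
    have TD_int: "integrable M (\<lambda>s. T j s * D j s)"
    proof (rule Bochner_Integration.integrable_bound)
      show "integrable M (\<lambda>s. (T j s)\<^sup>2 + (D j s)\<^sup>2)" using T_sq D_sq by simp
      have "\<bar>T j s * D j s\<bar> \<le> (T j s)\<^sup>2 + (D j s)\<^sup>2" for s
        using sum_squares_bound[of "\<bar>T j s\<bar>" "\<bar>D j s\<bar>"]
          mult_nonneg_nonneg[OF abs_ge_zero[of "T j s"] abs_ge_zero[of "D j s"]]
        unfolding abs_mult power2_abs by linarith
      thus "AE s in M. norm (T j s * D j s) \<le> norm ((T j s)\<^sup>2 + (D j s)\<^sup>2)" by auto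
    qed simp
    have "expectation (\<lambda>s. T j s * D j s) = 0"
      using orth[OF z] by (simp add: TD cong: Bochner_Integration.integral_cong)
    moreover have "(\<lambda>s. (T (Suc j) s)\<^sup>2) = (\<lambda>s. (T j s)\<^sup>2 + 2 * (T j s * D j s) + (D j s)\<^sup>2)"
      by (simp add: fun_eq_iff TSuc D_def power2_eq_square algebra_simps)
    ultimately have "expectation (\<lambda>s. (T (Suc j) s)\<^sup>2) = expectation (\<lambda>s. (T j s)\<^sup>2) + expectation (\<lambda>s. (D j s)\<^sup>2)"
      using T_sq D_sq TD_int by simp
    also have "expectation (\<lambda>s. (D j s)\<^sup>2) \<le> expectation (\<lambda>s. (d (m + j) s)\<^sup>2)"
      using D_sq sq_int by (intro integral_mono) (auto simp: D_def)
    finally show ?case using Suc by simp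
  qed (simp add: T0)
  hence ET: "expectation (\<lambda>s. (T j s)\<^sup>2) \<le> (\<Sum>k<j. expectation (\<lambda>s. (d (m + k) s)\<^sup>2))" .
  \<comment> \<open>Either no partial sum has left the interval and \<open>T\<close> is still the
    plain sum, or \<open>T\<close> is frozen outside. An exit up to time \<open>j\<close> is
    therefore visible in \<open>T j\<close> alone.\<close>
  have stop: "((\<forall>i\<le>j. \<bar>\<Sum>k<i. d (m + k) s\<bar> < \<epsilon>) \<and> T j s = (\<Sum>k<j. d (m + k) s)) \<or> \<epsilon> \<le> \<bar>T j s\<bar>" for s
  proof (induction j)
    case (Suc j)
    thus ?case by (auto simp: TSuc le_Suc_eq)
  qed (use \<epsilon> in \<open>simp add: T0\<close>)
  have "prob {s \<in> space M. \<exists>i\<le>j. \<epsilon> \<le> \<bar>\<Sum>k<i. d (m + k) s\<bar>} \<le> prob {s \<in> space M. \<epsilon>\<^sup>2 \<le> (T j s)\<^sup>2}"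
  proof (rule finite_measure_mono)
    show "{s \<in> space M. \<exists>i\<le>j. \<epsilon> \<le> \<bar>\<Sum>k<i. d (m + k) s\<bar>} \<subseteq> {s \<in> space M. \<epsilon>\<^sup>2 \<le> (T j s)\<^sup>2}"
    proof safe
      fix s i assume "i \<le> j" "\<epsilon> \<le> \<bar>\<Sum>k<i. d (m + k) s\<bar>"
      hence "\<epsilon> \<le> \<bar>T j s\<bar>" using stop[of s] by (meson not_less)
      thus "\<epsilon>\<^sup>2 \<le> (T j s)\<^sup>2" using \<epsilon> by (metis abs_of_pos abs_le_square_iff)
    qed
  qed measurable
  also have "\<dots> \<le> expectation (\<lambda>s. (T j s)\<^sup>2) / \<epsilon>\<^sup>2"
    using \<epsilon> T_sq by (intro integral_Markov_inequality_measure[where A = "space M"]) auto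
  also have "\<dots> \<le> (\<Sum>k<j. expectation (\<lambda>s. (d (m + k) s)\<^sup>2)) / \<epsilon>\<^sup>2"
    using ET by (intro divide_right_mono) auto
  finally show ?thesis .
qed

text \<open>The maximal inequality, started at time \<open>m\<close>, bounds the probability of a
  later excursion by a tail of the summable second moments. Hence almost surely each tolerance has a
  time after which no excursion of that size occurs, which is the Cauchy property.\<close>

lemma L2_martingale_convergent:
  assumes summ: "summable (\<lambda>n. expectation (\<lambda>s. (d n s)\<^sup>2))"
  shows "AE s in M. convergent (\<lambda>n. \<Sum>k<n. d k s)"
proof -
  note [measurable] = martingale_difference_measurable
  define E where "E n = expectation (\<lambda>s. (d n s)\<^sup>2)" for n
  have sE: "summable E" using summ by (simp add: E_def[abs_def])
  have E0: "E n \<ge> 0" for n by (simp add: E_def)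
  define B where "B \<epsilon> m = {s \<in> space M. \<exists>i. \<epsilon> \<le> \<bar>\<Sum>k<i. d (m + k) s\<bar>}" for \<epsilon> m
  have B_meas: "B \<epsilon> m \<in> events" for \<epsilon> m unfolding B_def by measurable
  have B_prob: "prob (B \<epsilon> m) \<le> (\<Sum>k. E (k + m)) / \<epsilon>\<^sup>2" if \<epsilon>: "\<epsilon> > 0" for \<epsilon> m
  proof -
    define A where "A j = {s \<in> space M. \<exists>i\<le>j. \<epsilon> \<le> \<bar>\<Sum>k<i. d (m + k) s\<bar>}" for j
    \<comment> \<open>Continuity from below removes the finite horizon \<open>j\<close>.\<close>
    have "(\<lambda>j. prob (A j)) \<longlonglongrightarrow> prob (\<Union>j. A j)"
    proof (rule finite_Lim_measure_incseq)
      show "range A \<subseteq> events" unfolding A_def by auto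
      show "incseq A" unfolding A_def incseq_def by (auto intro: order_trans)
    qed
    moreover have "(\<Union>j. A j) = B \<epsilon> m" by (auto simp: A_def B_def)
    moreover have "prob (A j) \<le> (\<Sum>k. E (k + m)) / \<epsilon>\<^sup>2" for j
    proof -
      have "summable (\<lambda>k. E (k + m))" using sE by (rule summable_ignore_initial_segment)
      hence "(\<Sum>k<j. E (k + m)) \<le> (\<Sum>k. E (k + m))" using E0 by (intro sum_le_suminf) auto
      hence "(\<Sum>k<j. E (m + k)) / \<epsilon>\<^sup>2 \<le> (\<Sum>k. E (k + m)) / \<epsilon>\<^sup>2"
        by (intro divide_right_mono) (auto simp: add.commute)
      thus ?thesis using maximal_inequality[OF \<epsilon>, of j m] by (simp add: A_def E_def)
    qed
    ultimately show ?thesis by (auto intro: LIMSEQ_le_const2)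
  qed
  have "AE s in M. \<exists>m. \<forall>i. \<bar>\<Sum>k<i. d (m + k) s\<bar> < \<epsilon>" if \<epsilon>: "\<epsilon> > 0" for \<epsilon>
  proof (rule AE_I')
    \<comment> \<open>\<open>Z\<close> collects the paths with an excursion of size at least
      \<open>\<epsilon>\<close> after every starting time; it lies in each
      \<open>B \<epsilon> m\<close>, whose probability becomes arbitrarily small.\<close>
    define Z where "Z = (\<Inter>m. B \<epsilon> m)"
    have Z_meas: "Z \<in> events" using B_meas by (auto simp: Z_def)
    have "prob Z \<le> r" if r: "r > 0" for r
    proof -
      have "r * \<epsilon>\<^sup>2 > 0" using r \<epsilon> by simp
      then obtain m where m: "norm (\<Sum>k. E (k + m)) < r * \<epsilon>\<^sup>2"
        using suminf_exist_split[of "r * \<epsilon>\<^sup>2" E] sE by blast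
      have "prob Z \<le> prob (B \<epsilon> m)" by (rule finite_measure_mono[OF _ B_meas]) (auto simp: Z_def)
      also have "\<dots> \<le> (\<Sum>k. E (k + m)) / \<epsilon>\<^sup>2" by (rule B_prob[OF \<epsilon>])
      also have "\<dots> \<le> r" using m \<epsilon> by (simp add: divide_le_eq)
      finally show ?thesis .
    qed
    hence "prob Z \<le> 0" by (rule field_le_epsilon[of _ 0, simplified])
    hence "prob Z = 0" by (simp add: measure_le_0_iff)
    thus "Z \<in> null_sets M" using Z_meas by (auto simp: null_sets_def emeasure_eq_measure)
    show "{s \<in> space M. \<not> (\<exists>m. \<forall>i. \<bar>\<Sum>k<i. d (m + k) s\<bar> < \<epsilon>)} \<subseteq> Z"
      by (auto simp: Z_def B_def not_less)
  qed
  hence "AE s in M. \<forall>q. \<exists>m. \<forall>i. \<bar>\<Sum>k<i. d (m + k) s\<bar> < 1 / real (Suc q)"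
    by (subst AE_all_countable) simp
  thus ?thesis
  proof eventually_elim
    case (elim s)
    have "Cauchy (\<lambda>n. \<Sum>k<n. d k s)"
    proof (rule metric_CauchyI)
      fix r :: real assume "r > 0"
      then obtain q where q: "1 / real (Suc q) < r / 2" using nat_approx_posE[of "r / 2"] by auto
      obtain m where m: "\<And>i. \<bar>\<Sum>k<i. d (m + k) s\<bar> < 1 / real (Suc q)" using elim by blast
      have split: "(\<Sum>k<m + j. d k s) = (\<Sum>k<m. d k s) + (\<Sum>k<j. d (m + k) s)" for j
        by (induction j) auto
      have "dist (\<Sum>k<a. d k s) (\<Sum>k<b. d k s) < r" if ab: "a \<ge> m" "b \<ge> m" for a b
        using m[of "a - m"] m[of "b - m"] q split[of "a - m", unfolded le_add_diff_inverse[OF ab(1)]]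
          split[of "b - m", unfolded le_add_diff_inverse[OF ab(2)]]
        unfolding dist_real_def by linarith
      thus "\<exists>M. \<forall>a\<ge>M. \<forall>b\<ge>M. dist (\<Sum>k<a. d k s) (\<Sum>k<b. d k s) < r" by blast
    qed
    thus ?case by (simp add: Cauchy_convergent_iff)
  qed
qed

end
end

text \<open>The functional is a continuous image of its sequence of real coordinates, and
  measurability of that sequence is checked coordinate by coordinate.\<close>

lemma blinfun_measurable_coordinatewise:
  fixes y :: "'s \<Rightarrow> ('v::real_normed_vector \<Rightarrow>\<^sub>L real)" and e :: "nat \<Rightarrow> 'v \<Rightarrow>\<^sub>L real"
  assumes expand: "\<And>y :: 'v \<Rightarrow>\<^sub>L real. y = (\<Sum>i<d. blinfun_apply y (b i) *\<^sub>R e i)"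
    and meas: "\<And>i. (\<lambda>s. blinfun_apply (y s) (b i)) \<in> borel_measurable N"
  shows "y \<in> borel_measurable N"
proof -
  have "(\<lambda>s i. blinfun_apply (y s) (b i)) \<in> borel_measurable N"
    using meas by (rule measurable_coordinatewise_then_product)
  moreover have "(\<lambda>a :: nat \<Rightarrow> real. \<Sum>i<d. a i *\<^sub>R e i) \<in> borel_measurable borel"
    by (intro borel_measurable_continuous_onI continuous_intros) auto
  ultimately have "(\<lambda>s. \<Sum>i<d. blinfun_apply (y s) (b i) *\<^sub>R e i) \<in> borel_measurable N"
    by (rule measurable_compose)
  thus ?thesis by (simp only: expand[symmetric])
qed

section \<open>Integration against a fresh independent sample\<close>

context prob_space
begin

context
  fixes P :: "'w measure" and N :: "'h measure" and H :: "'a \<Rightarrow> 'h" and W :: "'a \<Rightarrow> 'w"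
  assumes H: "H \<in> M \<rightarrow>\<^sub>M N" and W: "W \<in> M \<rightarrow>\<^sub>M P" and distr_W: "distr M P W = P"
    and joint: "distr M (N \<Otimes>\<^sub>M P) (\<lambda>s. (H s, W s)) = distr M N H \<Otimes>\<^sub>M P"
begin

lemma indep_pair: "(\<lambda>s. (H s, W s)) \<in> M \<rightarrow>\<^sub>M N \<Otimes>\<^sub>M P" "prob_space P" "prob_space (distr M N H)"
  using H W prob_space_distr[OF W] prob_space_distr[OF H] by (simp_all add: distr_W)

text \<open>By Tonelli for the product law, a bound on the inner integral that is uniform over
  frozen histories passes to the expectation. The third conclusion prepares the use of Fubini in
  \<open>indep_orthogonal\<close>.\<close>

lemma indep_square_bound:
  fixes \<zeta> :: "'h \<times> 'w \<Rightarrow> real"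
  assumes \<zeta> [measurable]: "\<zeta> \<in> borel_measurable (N \<Otimes>\<^sub>M P)"
    and sq: "\<And>x. x \<in> space N \<Longrightarrow> integrable P (\<lambda>w. (\<zeta> (x, w))\<^sup>2)"
      "\<And>x. x \<in> space N \<Longrightarrow> (\<integral>w. (\<zeta> (x, w))\<^sup>2 \<partial>P) \<le> c"
  shows "integrable M (\<lambda>s. (\<zeta> (H s, W s))\<^sup>2)" "expectation (\<lambda>s. (\<zeta> (H s, W s))\<^sup>2) \<le> c"
    "integrable (distr M N H \<Otimes>\<^sub>M P) \<zeta>"
proof -
  interpret P: prob_space P by (rule indep_pair(2))
  interpret D: prob_space "distr M N H" by (rule indep_pair(3))
  interpret DP: pair_prob_space "distr M N H" P ..
  have \<zeta>' [measurable]: "\<zeta> \<in> borel_measurable (distr M N H \<Otimes>\<^sub>M P)"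
    using \<zeta> by (simp cong: measurable_cong_sets)
  \<comment> \<open>Some point of the history space is needed to read off that \<open>c\<close> is
    nonnegative, which the return from \<open>ennreal\<close> to real bounds uses.\<close>
  obtain x0 where "x0 \<in> space N"
    using measurable_space[OF H] not_empty by blast
  from sq(2)[OF this] have c0: "c \<ge> 0"
    by (rule order_trans[rotated]) simp
  have "(\<integral>\<^sup>+p. ennreal ((\<zeta> p)\<^sup>2) \<partial>(distr M N H \<Otimes>\<^sub>M P))
      = (\<integral>\<^sup>+x. (\<integral>\<^sup>+w. ennreal ((\<zeta> (x, w))\<^sup>2) \<partial>P) \<partial>distr M N H)"
    by (rule P.nn_integral_fst[symmetric]) measurable
  also have "\<dots> \<le> (\<integral>\<^sup>+x. ennreal c \<partial>distr M N H)"
  proof (rule nn_integral_mono)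
    fix x assume "x \<in> space (distr M N H)"
    hence x: "x \<in> space N" by simp
    show "(\<integral>\<^sup>+w. ennreal ((\<zeta> (x, w))\<^sup>2) \<partial>P) \<le> ennreal c"
      using sq[OF x] by (subst nn_integral_eq_integral) (auto intro: ennreal_leI)
  qed
  also have "\<dots> = ennreal c" using D.emeasure_space_1 by simp
  finally have le: "(\<integral>\<^sup>+p. ennreal ((\<zeta> p)\<^sup>2) \<partial>(distr M N H \<Otimes>\<^sub>M P)) \<le> ennreal c" .
  have int: "integrable (distr M N H \<Otimes>\<^sub>M P) (\<lambda>p. (\<zeta> p)\<^sup>2)"
  proof (rule integrableI_nonneg)
    show "(\<lambda>p. (\<zeta> p)\<^sup>2) \<in> borel_measurable (distr M N H \<Otimes>\<^sub>M P)" by measurable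
    show "AE p in distr M N H \<Otimes>\<^sub>M P. 0 \<le> (\<zeta> p)\<^sup>2" by (rule AE_I2) (rule zero_le_power2)
    show "(\<integral>\<^sup>+p. ennreal ((\<zeta> p)\<^sup>2) \<partial>(distr M N H \<Otimes>\<^sub>M P)) < \<infinity>"
      by (rule le_less_trans[OF le]) simp
  qed
  show "integrable (distr M N H \<Otimes>\<^sub>M P) \<zeta>"
    by (rule finite_measure.square_integrable_imp_integrable[OF prob_space.finite_measure[OF prob_space_pair[OF indep_pair(3) indep_pair(2)]] \<zeta>' int])
  have sq_meas: "(\<lambda>p. (\<zeta> p)\<^sup>2) \<in> borel_measurable (N \<Otimes>\<^sub>M P)" by measurable
  show "integrable M (\<lambda>s. (\<zeta> (H s, W s))\<^sup>2)"
    using int unfolding joint[symmetric] integrable_distr_eq[OF indep_pair(1) sq_meas] .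
  have "expectation (\<lambda>s. (\<zeta> (H s, W s))\<^sup>2) = (\<integral>p. (\<zeta> p)\<^sup>2 \<partial>(distr M N H \<Otimes>\<^sub>M P))"
    unfolding joint[symmetric] integral_distr[OF indep_pair(1) sq_meas] ..
  also have "\<dots> \<le> c"
    using le nn_integral_eq_integral[OF int] c0 by (simp add: ennreal_le_iff)
  finally show "expectation (\<lambda>s. (\<zeta> (H s, W s))\<^sup>2) \<le> c" .
qed

text \<open>The factor \<open>z\<close> depends on the history alone, so in the iterated integral it
  multiplies a vanishing inner mean; its boundedness makes the product integrable.\<close>

lemma indep_orthogonal:
  fixes \<zeta> :: "'h \<times> 'w \<Rightarrow> real"
  assumes \<zeta> [measurable]: "\<zeta> \<in> borel_measurable (N \<Otimes>\<^sub>M P)"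
    and sq: "\<And>x. x \<in> space N \<Longrightarrow> integrable P (\<lambda>w. (\<zeta> (x, w))\<^sup>2)"
      "\<And>x. x \<in> space N \<Longrightarrow> (\<integral>w. (\<zeta> (x, w))\<^sup>2 \<partial>P) \<le> c"
    and mean: "\<And>x. x \<in> space N \<Longrightarrow> (\<integral>w. \<zeta> (x, w) \<partial>P) = 0"
    and z [measurable]: "z \<in> borel_measurable N" and z_bound: "\<And>x. \<bar>z x\<bar> \<le> B"
  shows "expectation (\<lambda>s. z (H s) * \<zeta> (H s, W s)) = 0"
proof -
  interpret P: prob_space P by (rule indep_pair(2))
  interpret D: prob_space "distr M N H" by (rule indep_pair(3))
  interpret DP: pair_prob_space "distr M N H" P ..
  have z\<zeta>: "(\<lambda>p. z (fst p) * \<zeta> p) \<in> borel_measurable (N \<Otimes>\<^sub>M P)" by measurable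
  have int: "integrable (distr M N H \<Otimes>\<^sub>M P) (\<lambda>p. z (fst p) * \<zeta> p)"
  proof (rule Bochner_Integration.integrable_bound)
    show "integrable (distr M N H \<Otimes>\<^sub>M P) (\<lambda>p. B * \<zeta> p)"
      using indep_square_bound(3)[OF \<zeta> sq] by simp
    show "(\<lambda>p. z (fst p) * \<zeta> p) \<in> borel_measurable (distr M N H \<Otimes>\<^sub>M P)"
      using z\<zeta> by (simp cong: measurable_cong_sets)
    show "AE p in distr M N H \<Otimes>\<^sub>M P. norm (z (fst p) * \<zeta> p) \<le> norm (B * \<zeta> p)"
      by (intro AE_I2)
        (simp add: abs_mult mult_right_mono[OF order_trans[OF z_bound abs_ge_self] abs_ge_zero])
  qed
  have "expectation (\<lambda>s. z (H s) * \<zeta> (H s, W s))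
      = (\<integral>p. z (fst p) * \<zeta> p \<partial>(distr M N H \<Otimes>\<^sub>M P))"
    unfolding joint[symmetric] integral_distr[OF indep_pair(1) z\<zeta>] by simp
  also have "\<dots> = (\<integral>x. (\<integral>w. z (fst (x, w)) * \<zeta> (x, w) \<partial>P) \<partial>distr M N H)"
    by (rule DP.integral_fst'[OF int, symmetric])
  also have "\<dots> = (\<integral>x. 0 \<partial>distr M N H)"
    by (rule Bochner_Integration.integral_cong) (auto simp: mean)
  finally show ?thesis by simp
qed

end

text \<open>For nonnegative terms the expectation of the series is the series of expectations, here
  finite, so the random series is finite almost everywhere.\<close>

lemma AE_summable_of_expectation:
  fixes u :: "nat \<Rightarrow> 'a \<Rightarrow> real"
  assumes int: "\<And>n. integrable M (u n)" and nonneg: "\<And>n s. u n s \<ge> 0"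
    and le: "\<And>n. expectation (u n) \<le> a n" and a: "summable a"
  shows "AE s in M. summable (\<lambda>n. u n s)"
proof -
  have [measurable]: "u n \<in> borel_measurable M" for n using int by auto
  have E0: "expectation (u n) \<ge> 0" for n using nonneg by simp
  have sE: "summable (\<lambda>n. expectation (u n))"
    using a le E0 by (intro summable_comparison_test'[OF a, of 0]) auto
  have "(\<integral>\<^sup>+s. (\<Sum>n. ennreal (u n s)) \<partial>M) = (\<Sum>n. \<integral>\<^sup>+s. ennreal (u n s) \<partial>M)"
    by (rule nn_integral_suminf) measurable
  also have "\<dots> = (\<Sum>n. ennreal (expectation (u n)))"
    using int nonneg by (simp add: nn_integral_eq_integral)
  also have "\<dots> = ennreal (\<Sum>n. expectation (u n))"
    by (rule suminf_ennreal2[OF E0 sE])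
  finally have "(\<integral>\<^sup>+s. (\<Sum>n. ennreal (u n s)) \<partial>M) \<noteq> \<infinity>" by simp
  hence "AE s in M. (\<Sum>n. ennreal (u n s)) \<noteq> \<infinity>"
    by (rule nn_integral_noteq_infinite[rotated]) measurable
  thus ?thesis
  proof eventually_elim
    case (elim s)
    show ?case
      by (rule summable_suminf_not_top[OF nonneg]) (use elim in \<open>simp add: infinity_ennreal_def\<close>)
  qed
qed

end

section \<open>Convergence along a sample path\<close>

context stochastic_objective
begin

text \<open>The situation on one sample path, counted from 0. Randomness enters only through
  \<open>second_order\<close>, \<open>noise_drift\<close> and \<open>noise_bounded\<close>, which
  are later shown to hold almost surely.\<close>

context
  fixes h :: "'v \<Rightarrow> real" and K :: real and xs :: 'v
    and g :: "nat \<Rightarrow> real" and x :: "nat \<Rightarrow> 'v" and y G :: "nat \<Rightarrow> 'v \<Rightarrow>\<^sub>L real"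
  assumes contH: "continuous_on C h" and K_pos: "K > 0" and sc: "strongly_convex_on K C h"
    and reciprocity: "\<And>y. (\<lambda>n. mirror_map C h (y n)) \<longlonglongrightarrow> xs \<Longrightarrow> (\<lambda>n. fenchel_coupling C h xs (y n)) \<longlonglongrightarrow> 0"
    and coherent: "variationally_coherent C f" and sharp: "sharp_minimum C f xs"
    and surj: "range (mirror_map C h) = C"
    and g_pos: "\<And>n. g n > 0" and g_sum: "filterlim (\<lambda>n. \<Sum>k<n. g k) at_top sequentially"
    and x_eq: "\<And>n. x n = mirror_map C h (y n)"
    and y_step: "\<And>n. y (Suc n) = y n - g n *\<^sub>R G n"
    and second_order: "summable (\<lambda>n. (g n)\<^sup>2 * (norm (G n))\<^sup>2)"
    and noise_drift: "convergent (\<lambda>n. \<Sum>k<n. g k * blinfun_apply (G k - mean_grad (x k)) (x k - xs))"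
    and noise_bounded: "Bseq (\<lambda>n. \<Sum>k<n. g k *\<^sub>R (G k - mean_grad (x k)))"
begin

lemmas mirror = compact nonempty convex contH K_pos sc

lemma xs_in_C: "xs \<in> C" using sharp by (simp add: sharp_minimum_def)

lemma x_in_C: "x n \<in> C" unfolding x_eq by (rule mirror_map_in[OF mirror])

lemma iterates_converge: "x \<longlonglongrightarrow> xs"
proof -
  define a where "a n = fenchel_coupling C h xs (y n)" for n
  define v where "v n = blinfun_apply (mean_grad (x n)) (x n - xs)" for n
  define N where "N n = g n * blinfun_apply (G n - mean_grad (x n)) (x n - xs)" for n
  define r where "r n = (g n)\<^sup>2 * (norm (G n))\<^sup>2 / (2 * K)" for n
  have ge: "K / 2 * (norm (x n - xs))\<^sup>2 \<le> a n" for n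
    unfolding a_def x_eq by (rule fenchel_coupling_ge[OF mirror xs_in_C])
  have step: "a (Suc n) \<le> a n - g n * v n - N n + r n" for n
    using fenchel_coupling_step[OF mirror, of xs "y n" "- g n *\<^sub>R G n"]
    by (simp add: a_def v_def N_def r_def y_step x_eq[symmetric] blinfun.bilinear_simps
        power_mult_distrib algebra_simps)
  have a0: "a n \<ge> 0" for n
    using K_pos by (intro order_trans[OF _ ge[of n]]) simp
  have v0: "v n \<ge> 0" for n
    unfolding v_def by (rule coherent_sharp_minimum(2)[OF coherent sharp x_in_C])
  have gv0: "g n * v n \<ge> 0" for n using v0 g_pos by (simp add: less_imp_le)
  have conv: "convergent a" "summable (\<lambda>n. g n * v n)"
    using perturbed_decrease_convergent[of a "\<lambda>n. g n * v n" N r, OF a0 gv0 step] noise_drift second_order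
    by (simp_all add: N_def r_def[abs_def] summable_divide)
  have "\<exists>n\<ge>m. v n < 1 / real (Suc m)" for m
    by (rule summable_weighted_imp_small[OF g_pos g_sum conv(2)]) simp
  \<comment> \<open>\<open>q\<close> need not be increasing; \<open>q m \<ge> m\<close> suffices for
    the composed indices \<open>p\<close> to tend to infinity.\<close>
  then obtain q where q: "\<And>m. q m \<ge> m" "\<And>m. v (q m) < 1 / real (Suc m)" by metis
  obtain l s where l: "l \<in> C" and s: "strict_mono s" and lim: "((\<lambda>m. x (q m)) \<circ> s) \<longlonglongrightarrow> l"
    using compact x_in_C unfolding compact_def by (metis (no_types, lifting))
  define p where "p m = q (s m)" for m
  have xp: "(\<lambda>m. x (p m)) \<longlonglongrightarrow> l" using lim by (simp add: o_def p_def)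
  have "(\<lambda>m. v (q m)) \<longlonglongrightarrow> 0"
    by (rule LIMSEQ_norm_0) (use v0 q(2) in auto)
  hence vp0: "(\<lambda>m. v (p m)) \<longlonglongrightarrow> 0"
    using LIMSEQ_subseq_LIMSEQ[OF _ s] by (fastforce simp: o_def p_def)
  have "(\<lambda>m. mean_grad (x (p m))) \<longlonglongrightarrow> mean_grad l"
    using continuous_on_mean_grad l x_in_C xp by (auto simp: continuous_on_sequentially o_def)
  hence "(\<lambda>m. v (p m)) \<longlonglongrightarrow> blinfun_apply (mean_grad l) (l - xs)"
    unfolding v_def by (intro tendsto_intros xp)
  hence "blinfun_apply (mean_grad l) (l - xs) = 0" using vp0 LIMSEQ_unique by blast
  hence "l = xs" by (rule coherent_sharp_minimum(3)[OF coherent sharp l])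
  \<comment> \<open>Reciprocity is applied along the subsequence only. As the whole sequence
    \<open>a\<close> converges, this fixes its limit as 0, and \<open>ge\<close> transfers the limit
    to the iterates.\<close>
  hence ap0: "(\<lambda>m. a (p m)) \<longlonglongrightarrow> 0"
    unfolding a_def using xp by (intro reciprocity) (simp add: x_eq)
  have p_inf: "filterlim p at_top sequentially"
  proof (rule filterlim_at_top_mono[OF filterlim_subseq[OF s]])
    show "\<forall>\<^sub>F m in sequentially. s m \<le> p m" using q(1) by (simp add: p_def)
  qed
  obtain A where A: "a \<longlonglongrightarrow> A" using conv(1) by (auto simp: convergent_def)
  hence "(\<lambda>m. a (p m)) \<longlonglongrightarrow> A" using filterlim_compose[OF A p_inf] by simp
  hence "a \<longlonglongrightarrow> 0" using A ap0 LIMSEQ_unique by blast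
  hence "(\<lambda>n. 2 / K * a n) \<longlonglongrightarrow> 2 / K * 0" by (intro tendsto_intros)
  hence up: "(\<lambda>n. 2 / K * a n) \<longlonglongrightarrow> 0" by simp
  have le: "(norm (x n - xs))\<^sup>2 \<le> 2 / K * a n" for n
    using ge[of n] K_pos by (simp add: field_simps)
  have "(\<lambda>n. (norm (x n - xs))\<^sup>2) \<longlonglongrightarrow> 0"
    by (rule tendsto_sandwich[OF _ _ tendsto_const up]) (intro always_eventually allI le zero_le_power2)+
  hence "(\<lambda>n. sqrt ((norm (x n - xs))\<^sup>2)) \<longlonglongrightarrow> sqrt 0" by (rule tendsto_real_sqrt)
  hence "(\<lambda>n. norm (x n - xs)) \<longlonglongrightarrow> 0" by simp
  thus ?thesis by (rule LIM_zero_cancel[OF tendsto_norm_zero_cancel])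
qed

text \<open>
  Sharpness makes \<open>y\<close> drift to infinity uniformly along all directions of the tangent cone at \<open>xs\<close>, so
  that it ends up in the translated polar cone, which the mirror map sends to \<open>xs\<close>.
\<close>

lemma iterates_reach: "\<forall>\<^sub>F n in sequentially. x n = xs"
proof -
  obtain y' where y': "mirror_map C h y' = xs" using surj xs_in_C by (metis imageE)
  obtain \<rho> where \<rho>: "\<rho> > 0"
      "\<And>z. z \<in> C \<Longrightarrow> \<rho> * norm (z - xs) \<le> blinfun_apply (mean_grad xs) (z - xs)"
    using sharp_minimum_mean_grad[OF sharp] by metis
  define \<eta> where "\<eta> n = norm (mean_grad (x n) - mean_grad xs)" for n
  have "(\<lambda>n. mean_grad (x n)) \<longlonglongrightarrow> mean_grad xs"
    using continuous_on_mean_grad xs_in_C x_in_C iterates_converge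
    by (auto simp: continuous_on_sequentially o_def)
  hence "\<eta> \<longlonglongrightarrow> 0" unfolding \<eta>_def[abs_def] by (intro tendsto_norm_zero LIM_zero)
  hence "\<forall>\<^sub>F n in sequentially. \<eta> n < \<rho> / 2" using \<rho>(1) by (intro order_tendstoD) auto
  hence "\<forall>\<^sub>F n in sequentially. \<rho> / 2 \<le> \<rho> - \<eta> n" by eventually_elim simp
  \<comment> \<open>Close to \<open>xs\<close> the push per unit step is at least half the sharpness
    constant, so the weighted sums inherit the divergence of the step sizes.\<close>
  hence drift: "filterlim (\<lambda>n. \<Sum>k<n. g k * (\<rho> - \<eta> k)) at_top sequentially"
    using \<rho>(1) by (intro sum_weighted_at_top[OF g_pos g_sum, where \<delta> = "\<rho> / 2"]) auto
  define S where "S n = (\<Sum>k<n. g k *\<^sub>R (G k - mean_grad (x k)))" for n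
  obtain B where B: "\<And>n. norm (S n) \<le> B" using noise_bounded by (auto simp: Bseq_def S_def)
  have y_expand: "y n = y 0 - S n - (\<Sum>k<n. g k *\<^sub>R mean_grad (x k))" for n
    by (induction n) (auto simp: S_def y_step algebra_simps)
  \<comment> \<open>The threshold pays for the initial displacement from \<open>y'\<close> and for
    the noise. It does not depend on the direction, so one \<open>n\<close> serves all of
    \<open>C\<close>.\<close>
  have "\<forall>\<^sub>F n in sequentially. norm (y 0 - y') + B \<le> (\<Sum>k<n. g k * (\<rho> - \<eta> k))"
    using drift by (simp add: filterlim_at_top)
  thus ?thesis
  proof eventually_elim
    case (elim n)
    have "blinfun_apply (y n - y') (z - xs) \<le> 0" if z: "z \<in> C" for z
    proof -
      define u where "u = z - xs"
      have "g k * (\<rho> - \<eta> k) * norm u \<le> g k * blinfun_apply (mean_grad (x k)) u" for k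
      proof -
        have "- (\<eta> k * norm u) \<le> blinfun_apply (mean_grad (x k) - mean_grad xs) u"
          using norm_blinfun[of "mean_grad (x k) - mean_grad xs" u] by (simp add: \<eta>_def)
        hence "(\<rho> - \<eta> k) * norm u \<le> blinfun_apply (mean_grad (x k)) u"
          using \<rho>(2)[OF z] by (simp add: u_def blinfun.bilinear_simps algebra_simps)
        thus ?thesis using g_pos[of k] by (simp add: mult.assoc)
      qed
      hence "(\<Sum>k<n. g k * (\<rho> - \<eta> k) * norm u) \<le> (\<Sum>k<n. g k * blinfun_apply (mean_grad (x k)) u)"
        by (rule sum_mono)
      hence "(\<Sum>k<n. g k * (\<rho> - \<eta> k)) * norm u \<le> blinfun_apply (\<Sum>k<n. g k *\<^sub>R mean_grad (x k)) u"
        by (simp add: sum_distrib_right blinfun.sum_left blinfun.scaleR_left)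
      moreover have "(norm (y 0 - y') + B) * norm u \<le> (\<Sum>k<n. g k * (\<rho> - \<eta> k)) * norm u"
        using elim by (intro mult_right_mono) auto
      moreover have "blinfun_apply (y 0 - y' - S n) u \<le> (norm (y 0 - y') + B) * norm u"
      proof -
        have "blinfun_apply (y 0 - y' - S n) u \<le> norm (y 0 - y' - S n) * norm u"
          using norm_blinfun[of "y 0 - y' - S n" u] by simp
        also have "norm (y 0 - y' - S n) \<le> norm (y 0 - y') + B"
          using norm_triangle_ineq4[of "y 0 - y'" "S n"] B[of n] by simp
        finally show ?thesis by (simp add: mult_right_mono)
      qed
      moreover have "blinfun_apply (y n - y') u
          = blinfun_apply (y 0 - y' - S n) u - blinfun_apply (\<Sum>k<n. g k *\<^sub>R mean_grad (x k)) u"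
        by (simp add: y_expand[of n] blinfun.diff_left)
      ultimately show ?thesis by (simp add: u_def)
    qed
    thus ?case unfolding x_eq by (rule mirror_map_eq_polar[OF mirror y'])
  qed
qed

end
end

section \<open>The stochastic process\<close>

context stochastic_objective
begin

text \<open>The samples without a regular gradient are only known to lie inside a null set; one such
  null set is fixed once and for all.\<close>

definition exceptional :: "'w set" where
  "exceptional = (SOME N. N \<in> null_sets P \<and>
     {w \<in> space P. \<not> C1_with_gradient_on C (\<lambda>x. F x w) (\<lambda>x. gradF x w)} \<subseteq> N)"

text \<open>The modification on a null set makes the gradient continuous in \<open>x\<close> for
  every sample in the space, as \<open>Caratheodory_measurable\<close> demands.\<close>

definition regular_grad :: "'v \<Rightarrow> 'w \<Rightarrow> 'v \<Rightarrow>\<^sub>L real" where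
  "regular_grad x w = (if w \<in> exceptional then 0 else gradF x w)"

lemma exceptional:
  shows exceptional_null: "exceptional \<in> null_sets P"
    and exceptional_supset: "{w \<in> space P. \<not> C1_with_gradient_on C (\<lambda>x. F x w) (\<lambda>x. gradF x w)} \<subseteq> exceptional"
proof -
  have "\<exists>N. N \<in> null_sets P \<and> {w \<in> space P. \<not> C1_with_gradient_on C (\<lambda>x. F x w) (\<lambda>x. gradF x w)} \<subseteq> N"
    using AE_E[OF C1] by (metis (no_types, lifting) null_setsI)
  from someI_ex[OF this, folded exceptional_def]
  show "exceptional \<in> null_sets P"
    and "{w \<in> space P. \<not> C1_with_gradient_on C (\<lambda>x. F x w) (\<lambda>x. gradF x w)} \<subseteq> exceptional"
    by (rule conjunct1, rule conjunct2)
qed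

lemma AE_regular_grad: "AE w in P. regular_grad x w = gradF x w"
  using AE_not_in[OF exceptional_null] by eventually_elim (simp add: regular_grad_def)

lemma regular_grad_apply: "blinfun_apply (regular_grad x w) v = (if w \<in> exceptional then 0 else blinfun_apply (gradF x w) v)"
  by (simp add: regular_grad_def)

lemma regular_grad_measurable:
  assumes "x \<in> C"
  shows "(\<lambda>w. blinfun_apply (regular_grad x w) v) \<in> borel_measurable P"
proof -
  have "exceptional \<inter> space P \<in> sets P" using exceptional_null by auto
  thus ?thesis unfolding regular_grad_apply
    by (intro measurable_If_set measurable_const gradF_apply_measurable[OF assms]) auto
qed

lemma continuous_on_regular_grad:
  assumes "w \<in> space P"
  shows "continuous_on C (\<lambda>x. blinfun_apply (regular_grad x w) v)"
proof (cases "w \<in> exceptional")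
  case False
  hence "continuous_on C (\<lambda>x. gradF x w)"
    using exceptional_supset assms by (auto simp: C1_with_gradient_on_def)
  thus ?thesis using False by (simp add: regular_grad_apply) (intro continuous_intros)
qed (simp add: regular_grad_apply)

lemma regular_grad_moments:
  assumes x: "x \<in> C"
  shows "integrable P (\<lambda>w. blinfun_apply (regular_grad x w) v)"
    and "(\<integral>w. blinfun_apply (regular_grad x w) v \<partial>P) = blinfun_apply (mean_grad x) v"
    and "integrable P (\<lambda>w. (blinfun_apply (regular_grad x w) v)\<^sup>2)"
    and "(\<integral>w. (blinfun_apply (regular_grad x w) v)\<^sup>2 \<partial>P) \<le> V\<^sup>2 * (norm v)\<^sup>2"
proof -
  have eq: "AE w in P. blinfun_apply (regular_grad x w) v = blinfun_apply (gradF x w) v"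
    "AE w in P. (blinfun_apply (regular_grad x w) v)\<^sup>2 = (blinfun_apply (gradF x w) v)\<^sup>2"
    using AE_regular_grad[of x] by (auto elim: eventually_mono)
  note meas = regular_grad_measurable[OF x, of v] gradF_apply_measurable[OF x, of v]
  note sq_meas = meas[THEN borel_measurable_power, of 2]
  show "integrable P (\<lambda>w. blinfun_apply (regular_grad x w) v)"
    by (rule integrable_cong_AE[OF meas eq(1), THEN iffD2]) (rule gradF_apply_integrable[OF x])
  show "(\<integral>w. blinfun_apply (regular_grad x w) v \<partial>P) = blinfun_apply (mean_grad x) v"
    unfolding mean_grad_apply[OF x] by (rule integral_cong_AE[OF meas eq(1)])
  show "integrable P (\<lambda>w. (blinfun_apply (regular_grad x w) v)\<^sup>2)"
    by (rule integrable_cong_AE[OF sq_meas eq(2), THEN iffD2]) (rule gradF_apply_square_integrable(1)[OF x])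
  have "(\<integral>w. (blinfun_apply (regular_grad x w) v)\<^sup>2 \<partial>P) = (\<integral>w. (blinfun_apply (gradF x w) v)\<^sup>2 \<partial>P)"
    by (rule integral_cong_AE[OF sq_meas eq(2)])
  thus "(\<integral>w. (blinfun_apply (regular_grad x w) v)\<^sup>2 \<partial>P) \<le> V\<^sup>2 * (norm v)\<^sup>2"
    using gradF_apply_square_integrable(2)[OF x] by simp
qed

text \<open>The variance is the second moment minus the squared mean, so centering keeps the same
  bound.\<close>

lemma regular_grad_centered_square:
  assumes x: "x \<in> C"
  shows "integrable P (\<lambda>w. (blinfun_apply (regular_grad x w) v - blinfun_apply (mean_grad x) v)\<^sup>2)"
    and "(\<integral>w. (blinfun_apply (regular_grad x w) v - blinfun_apply (mean_grad x) v)\<^sup>2 \<partial>P) \<le> V\<^sup>2 * (norm v)\<^sup>2"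
proof -
  note mom = regular_grad_moments[OF x, of v]
  show "integrable P (\<lambda>w. (blinfun_apply (regular_grad x w) v - blinfun_apply (mean_grad x) v)\<^sup>2)"
    using mom(1,3) by (simp add: power2_diff)
  have "(\<integral>w. (blinfun_apply (regular_grad x w) v - blinfun_apply (mean_grad x) v)\<^sup>2 \<partial>P)
      = (\<integral>w. (blinfun_apply (regular_grad x w) v)\<^sup>2 \<partial>P) - (blinfun_apply (mean_grad x) v)\<^sup>2"
    using P.variance_eq[OF mom(1,3)] by (simp add: mom(2))
  thus "(\<integral>w. (blinfun_apply (regular_grad x w) v - blinfun_apply (mean_grad x) v)\<^sup>2 \<partial>P) \<le> V\<^sup>2 * (norm v)\<^sup>2"
    using mom(4) zero_le_power2[of "blinfun_apply (mean_grad x) v"] by linarith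
qed

end

locale stochastic_gradient_process =
  stochastic_objective P C F gradF f V + M: prob_space M
  for P :: "'w measure" and C :: "'v::real_normed_vector set" and F gradF f V and M :: "'s measure" +
  fixes Q :: "('v \<Rightarrow>\<^sub>L real) \<Rightarrow> 'v" and \<gamma> :: "nat \<Rightarrow> real" and y1 :: "'v \<Rightarrow>\<^sub>L real"
    and \<omega> :: "nat \<Rightarrow> 's \<Rightarrow> 'w"
  assumes Q_cont: "continuous_on UNIV Q" and Q_in: "\<And>y. Q y \<in> C"
    and indep: "M.indep_vars (\<lambda>_. P) \<omega> {1..}"
    and distributed: "\<And>n. n \<ge> 1 \<Longrightarrow> distr M P (\<omega> n) = P"
    and step_l2: "summable (\<lambda>n. (\<gamma> n)\<^sup>2)"
begin

text \<open>
  The dual iterate after \<open>n\<close> steps as a function of the sample path; only the samples with indices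
  \<open>1, \<dots>, n\<close> enter.
\<close>

primrec state :: "nat \<Rightarrow> (nat \<Rightarrow> 'w) \<Rightarrow> 'v \<Rightarrow>\<^sub>L real" where
  "state 0 p = y1"
| "state (Suc n) p = state n p - \<gamma> (Suc n) *\<^sub>R regular_grad (Q (state n p)) (p (Suc n))"

definition history :: "nat \<Rightarrow> 's \<Rightarrow> nat \<Rightarrow> 'w" where
  "history n s = (\<lambda>i\<in>{1..n}. \<omega> i s)"

abbreviation path_space :: "nat \<Rightarrow> (nat \<Rightarrow> 'w) measure" where
  "path_space n \<equiv> PiM {1..n} (\<lambda>_. P)"

lemma state_cong: "(\<And>i. i \<in> {1..n} \<Longrightarrow> p i = p' i) \<Longrightarrow> state n p = state n p'"
  by (induction n) auto

lemma state_history: "k \<le> n \<Longrightarrow> state k (history n s) = state k (\<lambda>i. \<omega> i s)"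
  by (rule state_cong) (auto simp: history_def)

lemma \<omega>_measurable: "n \<ge> 1 \<Longrightarrow> \<omega> n \<in> M \<rightarrow>\<^sub>M P"
  using indep by (auto simp: M.indep_vars_def)

lemma history_measurable: "history n \<in> M \<rightarrow>\<^sub>M path_space n"
  unfolding history_def by (rule measurable_restrict) (auto intro: \<omega>_measurable)

lemma Q_state_measurable:
  "state k \<in> borel_measurable (path_space n) \<Longrightarrow> (\<lambda>p. Q (state k p)) \<in> borel_measurable (path_space n)"
  by (rule measurable_compose[OF _ borel_measurable_continuous_onI[OF Q_cont]])

lemma regular_grad_joint_measurable:
  assumes "state k \<in> borel_measurable (path_space n)"
  shows "(\<lambda>(p, w). blinfun_apply (regular_grad (Q (state k p)) w) v) \<in> borel_measurable (path_space n \<Otimes>\<^sub>M P)"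
  by (rule Caratheodory_measurable[OF compact nonempty regular_grad_measurable continuous_on_regular_grad
        Q_state_measurable[OF assms] Q_in])

lemma state_measurable: "k \<le> n \<Longrightarrow> state k \<in> borel_measurable (path_space n)"
proof (induction k)
  case 0
  have "state 0 = (\<lambda>_. y1)" by (simp add: fun_eq_iff)
  thus ?case by (simp only: borel_measurable_const)
next
  case (Suc k)
  hence IH: "state k \<in> borel_measurable (path_space n)" by simp
  obtain d :: nat and b :: "nat \<Rightarrow> 'v" and e :: "nat \<Rightarrow> 'v \<Rightarrow>\<^sub>L real"
    where frame: "\<And>v. v = (\<Sum>i<d. blinfun_apply (e i) v *\<^sub>R b i)"
    using finite_dim_dual_frame[OF finite_dim] by blast
  show ?case
  proof (rule blinfun_measurable_coordinatewise[OF dual_frame_expansion[OF frame]])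
    fix i
    have 1: "(\<lambda>p. blinfun_apply (state k p) (b i)) \<in> borel_measurable (path_space n)"
      by (rule measurable_compose[OF IH borel_measurable_continuous_onI]) (intro continuous_intros)
    \<comment> \<open>The path is paired with its own coordinate \<open>Suc k\<close>, so joint
      measurability in history and fresh sample applies on a single path space.\<close>
    have "(\<lambda>p. (p, p (Suc k))) \<in> path_space n \<rightarrow>\<^sub>M path_space n \<Otimes>\<^sub>M P"
      using Suc.prems by (intro measurable_Pair measurable_ident measurable_component_singleton) auto
    from measurable_compose[OF this regular_grad_joint_measurable[OF IH]]
    have 2: "(\<lambda>p. blinfun_apply (regular_grad (Q (state k p)) (p (Suc k))) (b i)) \<in> borel_measurable (path_space n)"
      unfolding prod.case .
    show "(\<lambda>p. blinfun_apply (state (Suc k) p) (b i)) \<in> borel_measurable (path_space n)"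
      unfolding state.simps blinfun.diff_left blinfun.scaleR_left real_scaleR_def
      by (intro borel_measurable_diff borel_measurable_times borel_measurable_const 1 2)
  qed
qed

text \<open>The index blocks \<open>{1..n}\<close> and \<open>{Suc n}\<close> are disjoint, hence
  independent; evaluation at \<open>Suc n\<close> identifies the one-factor product space with
  \<open>P\<close>.\<close>

lemma joint_distribution:
  "distr M (path_space n \<Otimes>\<^sub>M P) (\<lambda>s. (history n s, \<omega> (Suc n) s)) = distr M (path_space n) (history n) \<Otimes>\<^sub>M P"
proof -
  let ?R = "\<lambda>s. \<lambda>i\<in>{Suc n}. \<omega> i s" and ?S = "PiM {Suc n} (\<lambda>_. P)"
  have "M.indep_var (path_space n) (history n) ?S ?R"
    unfolding history_def by (rule M.indep_var_restrict[OF indep]) auto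
  hence R: "?R \<in> M \<rightarrow>\<^sub>M ?S"
    and prod: "distr M (path_space n) (history n) \<Otimes>\<^sub>M distr M ?S ?R = distr M (path_space n \<Otimes>\<^sub>M ?S) (\<lambda>s. (history n s, ?R s))"
    unfolding M.indep_var_distribution_eq by auto
  have comp: "(\<lambda>p. p (Suc n)) \<in> ?S \<rightarrow>\<^sub>M P" by (rule measurable_component_singleton) simp
  have P_eq: "distr (distr M ?S ?R) P (\<lambda>p. p (Suc n)) = P"
    using distributed[of "Suc n"] by (simp add: distr_distr[OF comp R] o_def)
  have "distr M (path_space n) (history n) \<Otimes>\<^sub>M P
      = distr (distr M (path_space n) (history n)) (path_space n) (\<lambda>p. p)
        \<Otimes>\<^sub>M distr (distr M ?S ?R) P (\<lambda>p. p (Suc n))"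
    by (simp add: P_eq distr_id2)
  also have "\<dots> = distr (distr M (path_space n) (history n) \<Otimes>\<^sub>M distr M ?S ?R) (path_space n \<Otimes>\<^sub>M P)
      (\<lambda>(p, q). (p, q (Suc n)))"
    by (rule pair_measure_distr) (use comp P.sigma_finite_measure_axioms in \<open>auto simp: P_eq\<close>)
  also have "\<dots> = distr M (path_space n \<Otimes>\<^sub>M P) (\<lambda>s. (history n s, \<omega> (Suc n) s))"
    unfolding prod
  proof (subst distr_distr)
    show "(\<lambda>(p, q). (p, q (Suc n))) \<in> path_space n \<Otimes>\<^sub>M ?S \<rightarrow>\<^sub>M path_space n \<Otimes>\<^sub>M P"
      using comp by measurable
    show "(\<lambda>s. (history n s, ?R s)) \<in> M \<rightarrow>\<^sub>M path_space n \<Otimes>\<^sub>M ?S"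
      using history_measurable R by measurable
  qed (simp add: o_def)
  finally show ?thesis ..
qed

abbreviation primal :: "nat \<Rightarrow> 's \<Rightarrow> 'v" where
  "primal n s \<equiv> Q (state n (\<lambda>i. \<omega> i s))"

text \<open>The point \<open>primal n\<close> uses samples up to \<open>n\<close> only, and its
  gradient is drawn with sample \<open>Suc n\<close>, which is independent of it.\<close>

abbreviation sample_grad :: "nat \<Rightarrow> 's \<Rightarrow> 'v \<Rightarrow>\<^sub>L real" where
  "sample_grad n s \<equiv> regular_grad (primal n s) (\<omega> (Suc n) s)"

lemmas indep_sample = history_measurable \<omega>_measurable[of "Suc n" for n, simplified]
  distributed[of "Suc n" for n, simplified] joint_distribution

lemma step_l2_Suc: "summable (\<lambda>n. (\<gamma> (Suc n))\<^sup>2)"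
  using step_l2 summable_Suc_iff[of "\<lambda>n. (\<gamma> n)\<^sup>2"] by blast

lemma second_order_summable:
  "AE s in M. summable (\<lambda>n. (\<gamma> (Suc n))\<^sup>2 * (blinfun_apply (sample_grad n s) v)\<^sup>2)"
proof (rule M.AE_summable_of_expectation)
  fix n
  define \<zeta> where "\<zeta> = (\<lambda>(p, w). blinfun_apply (regular_grad (Q (state n p)) w) v)"
  have meas: "\<zeta> \<in> borel_measurable (path_space n \<Otimes>\<^sub>M P)"
    unfolding \<zeta>_def by (rule regular_grad_joint_measurable[OF state_measurable]) simp
  have eq: "\<zeta> (history n s, \<omega> (Suc n) s) = blinfun_apply (sample_grad n s) v" for s
    by (simp add: \<zeta>_def state_history)
  note sq = M.indep_square_bound[OF indep_sample meas, of "V\<^sup>2 * (norm v)\<^sup>2", unfolded eq]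
  have *: "integrable M (\<lambda>s. (blinfun_apply (sample_grad n s) v)\<^sup>2)"
      "M.expectation (\<lambda>s. (blinfun_apply (sample_grad n s) v)\<^sup>2) \<le> V\<^sup>2 * (norm v)\<^sup>2"
    using sq regular_grad_moments(3,4)[OF Q_in] by (auto simp: \<zeta>_def)
  show "integrable M (\<lambda>s. (\<gamma> (Suc n))\<^sup>2 * (blinfun_apply (sample_grad n s) v)\<^sup>2)" using *(1) by simp
  show "M.expectation (\<lambda>s. (\<gamma> (Suc n))\<^sup>2 * (blinfun_apply (sample_grad n s) v)\<^sup>2) \<le> (\<gamma> (Suc n))\<^sup>2 * (V\<^sup>2 * (norm v)\<^sup>2)"
    using *(2) by (simp add: mult_left_mono)
  show "summable (\<lambda>n. (\<gamma> (Suc n))\<^sup>2 * (V\<^sup>2 * (norm v)\<^sup>2))"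
    by (intro summable_mult2 step_l2_Suc)
qed simp

text \<open>The summands are martingale differences with second moments bounded by a multiple of the
  squared steps, as \<open>u\<close> is bounded on the compact \<open>C\<close>. The weight
  \<open>u\<close> is there so that coordinates of the current iterate can multiply the
  noise.\<close>

lemma noise_convergent:
  assumes u: "continuous_on UNIV u"
  shows "AE s in M. convergent (\<lambda>n. \<Sum>k<n. \<gamma> (Suc k) * (u (primal k s) *
           blinfun_apply (sample_grad k s - mean_grad (primal k s)) v))"
proof -
  have "compact (u ` C)" using u compact continuous_on_subset by (blast intro: compact_continuous_image)
  then obtain U where U: "\<And>x. x \<in> C \<Longrightarrow> \<bar>u x\<bar> \<le> U"
    using compact_imp_bounded by (fastforce simp: bounded_iff)
  define \<zeta> where "\<zeta> k = (\<lambda>(p, w). \<gamma> (Suc k) * (u (Q (state k p)) *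
      (blinfun_apply (regular_grad (Q (state k p)) w) v - blinfun_apply (mean_grad (Q (state k p))) v)))" for k
  define d where "d k s = \<gamma> (Suc k) * (u (primal k s) * blinfun_apply (sample_grad k s - mean_grad (primal k s)) v)" for k s
  define c where "c k = (\<gamma> (Suc k))\<^sup>2 * (U\<^sup>2 * (V\<^sup>2 * (norm v)\<^sup>2))" for k
  have meas: "\<zeta> k \<in> borel_measurable (path_space n \<Otimes>\<^sub>M P)" if "k \<le> n" for k n
  proof -
    note st = state_measurable[OF that]
    note joint = regular_grad_joint_measurable[OF st, of v]
    have u_meas: "(\<lambda>p. u (Q (state k p))) \<in> borel_measurable (path_space n)"
      by (rule measurable_compose[OF Q_state_measurable[OF st] borel_measurable_continuous_onI[OF u]])
    \<comment> \<open>The mean gradient along the path is measurable as a parametric integral of the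
      jointly measurable sampled gradient.\<close>
    have "(\<lambda>p. \<integral>w. blinfun_apply (regular_grad (Q (state k p)) w) v \<partial>P) \<in> borel_measurable (path_space n)"
      by (rule P.borel_measurable_lebesgue_integral[OF joint])
    hence mean_meas: "(\<lambda>p. blinfun_apply (mean_grad (Q (state k p))) v) \<in> borel_measurable (path_space n)"
      unfolding regular_grad_moments(2)[OF Q_in] .
    show ?thesis
      using joint unfolding \<zeta>_def case_prod_beta'
      by (intro borel_measurable_diff borel_measurable_times borel_measurable_const
          measurable_compose[OF measurable_fst u_meas] measurable_compose[OF measurable_fst mean_meas])
  qed
  have eq: "\<zeta> k (history n s, \<omega> (Suc k) s) = d k s" if "k \<le> n" for k n s
    using that by (simp add: \<zeta>_def d_def state_history blinfun.diff_left)
  have \<zeta>_sq: "integrable P (\<lambda>w. (\<zeta> k (p, w))\<^sup>2)" for k p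
    using regular_grad_centered_square(1)[OF Q_in] by (simp add: \<zeta>_def power_mult_distrib)
  have \<zeta>_bound: "(\<integral>w. (\<zeta> k (p, w))\<^sup>2 \<partial>P) \<le> c k" for k p
  proof -
    have "(u (Q (state k p)))\<^sup>2 \<le> U\<^sup>2" using U[OF Q_in] by (metis abs_ge_zero power2_abs power_mono)
    hence "(u (Q (state k p)))\<^sup>2 * (\<integral>w. (blinfun_apply (regular_grad (Q (state k p)) w) v
        - blinfun_apply (mean_grad (Q (state k p))) v)\<^sup>2 \<partial>P) \<le> U\<^sup>2 * (V\<^sup>2 * (norm v)\<^sup>2)"
      using regular_grad_centered_square(2)[OF Q_in] by (intro mult_mono) auto
    thus ?thesis by (simp add: \<zeta>_def c_def power_mult_distrib mult_left_mono)
  qed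
  have \<zeta>_mean: "(\<integral>w. \<zeta> k (p, w) \<partial>P) = 0" for k p
    using regular_grad_moments(1,2)[OF Q_in] by (simp add: \<zeta>_def P.prob_space)
  have sq: "integrable M (\<lambda>s. (d k s)\<^sup>2)" "M.expectation (\<lambda>s. (d k s)\<^sup>2) \<le> c k" for k
    using M.indep_square_bound(1,2)[OF indep_sample meas[OF order_refl] \<zeta>_sq \<zeta>_bound, of k]
    by (simp_all only: eq order_refl)
  have "AE s in M. convergent (\<lambda>n. \<Sum>k<n. d k s)"
  proof (rule M.L2_martingale_convergent[where N = path_space and H = history])
    show "history n \<in> M \<rightarrow>\<^sub>M path_space n" for n by (rule history_measurable)
    show "integrable M (\<lambda>s. (d n s)\<^sup>2)" for n by (rule sq)
    show "\<exists>\<delta>\<in>borel_measurable (path_space n). \<forall>s\<in>space M. d k s = \<delta> (history n s)" if "k < n" for k n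
    proof
      show "\<forall>s\<in>space M. d k s = (\<lambda>p. \<zeta> k (p, p (Suc k))) (history n s)"
        using that eq[of k n] by (auto simp: history_def)
      have "(\<lambda>p. (p, p (Suc k))) \<in> path_space n \<rightarrow>\<^sub>M path_space n \<Otimes>\<^sub>M P"
        using that by (intro measurable_Pair measurable_ident measurable_component_singleton) auto
      thus "(\<lambda>p. \<zeta> k (p, p (Suc k))) \<in> borel_measurable (path_space n)"
        by (rule measurable_compose[OF _ meas]) (use that in simp)
    qed
    show "M.expectation (\<lambda>s. z (history n s) * d n s) = 0"
      if z: "z \<in> borel_measurable (path_space n)" "\<And>x. \<bar>z x\<bar> \<le> B" for n z B
      using M.indep_orthogonal[OF indep_sample meas[OF order_refl] \<zeta>_sq \<zeta>_bound \<zeta>_mean z]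
      by (simp only: eq order_refl)
    show "summable (\<lambda>n. M.expectation (\<lambda>s. (d n s)\<^sup>2))"
    proof (rule summable_comparison_test')
      show "summable c" unfolding c_def by (intro summable_mult2 step_l2_Suc)
      show "norm (M.expectation (\<lambda>s. (d n s)\<^sup>2)) \<le> c n" if "n \<ge> 0" for n using sq(2)[of n] by simp
    qed
  qed
  thus ?thesis by (simp only: d_def)
qed

text \<open>Expansion in the dual frame reduces each claim to finitely many scalar series. The
  weight \<open>u\<close> is a coordinate of the iterate minus \<open>a\<close> for the first claim
  and the constant 1 for the second.\<close>

lemma noise_regular:
  "AE s in M. convergent (\<lambda>n. \<Sum>k<n. \<gamma> (Suc k) * blinfun_apply (sample_grad k s - mean_grad (primal k s)) (primal k s - a))
     \<and> Bseq (\<lambda>n. \<Sum>k<n. \<gamma> (Suc k) *\<^sub>R (sample_grad k s - mean_grad (primal k s)))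
     \<and> summable (\<lambda>n. (\<gamma> (Suc n))\<^sup>2 * (norm (sample_grad n s))\<^sup>2)"
proof -
  obtain d :: nat and b :: "nat \<Rightarrow> 'v" and e :: "nat \<Rightarrow> 'v \<Rightarrow>\<^sub>L real"
    where frame: "\<And>v. v = (\<Sum>i<d. blinfun_apply (e i) v *\<^sub>R b i)"
    using finite_dim_dual_frame[OF finite_dim] by blast
  have expand: "y = (\<Sum>i<d. blinfun_apply y (b i) *\<^sub>R e i)" for y :: "'v \<Rightarrow>\<^sub>L real"
    by (rule dual_frame_expansion[OF frame])
  define \<xi> where "\<xi> k s = sample_grad k s - mean_grad (primal k s)" for k s
  have "AE s in M. \<forall>i. convergent (\<lambda>n. \<Sum>k<n. \<gamma> (Suc k) * (blinfun_apply (e i) (primal k s - a) * blinfun_apply (\<xi> k s) (b i)))"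
    unfolding AE_all_countable \<xi>_def by (intro allI noise_convergent continuous_intros)
  moreover have "AE s in M. \<forall>i. convergent (\<lambda>n. \<Sum>k<n. \<gamma> (Suc k) * (1 * blinfun_apply (\<xi> k s) (b i)))"
    unfolding AE_all_countable \<xi>_def by (intro allI noise_convergent continuous_intros)
  moreover have "AE s in M. \<forall>i. summable (\<lambda>n. (\<gamma> (Suc n))\<^sup>2 * (blinfun_apply (sample_grad n s) (b i))\<^sup>2)"
    unfolding AE_all_countable by (intro allI second_order_summable)
  ultimately show ?thesis
  proof eventually_elim
    case (elim s)
    have \<xi>_apply: "blinfun_apply (\<xi> k s) v = (\<Sum>i<d. blinfun_apply (e i) v * blinfun_apply (\<xi> k s) (b i))" for k v
      using arg_cong[OF expand[of "\<xi> k s"], of "\<lambda>y. blinfun_apply y v"]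
      unfolding blinfun.sum_left blinfun.scaleR_left real_scaleR_def by (simp only: mult.commute)
    have "(\<Sum>k<n. \<gamma> (Suc k) * blinfun_apply (\<xi> k s) (primal k s - a))
        = (\<Sum>i<d. \<Sum>k<n. \<gamma> (Suc k) * (blinfun_apply (e i) (primal k s - a) * blinfun_apply (\<xi> k s) (b i)))" for n
      by (subst sum.swap, intro sum.cong refl, subst \<xi>_apply, rule sum_distrib_left)
    moreover have "convergent (\<lambda>n. \<Sum>i<d. \<Sum>k<n. \<gamma> (Suc k) * (blinfun_apply (e i) (primal k s - a) * blinfun_apply (\<xi> k s) (b i)))"
      using elim(1) by (intro convergent_sum) blast
    ultimately have 1: "convergent (\<lambda>n. \<Sum>k<n. \<gamma> (Suc k) * blinfun_apply (\<xi> k s) (primal k s - a))" by simp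
    have "(\<Sum>k<n. \<gamma> (Suc k) *\<^sub>R \<xi> k s) = (\<Sum>i<d. (\<Sum>k<n. \<gamma> (Suc k) * (1 * blinfun_apply (\<xi> k s) (b i))) *\<^sub>R e i)" for n
      using expand[of "\<Sum>k<n. \<gamma> (Suc k) *\<^sub>R \<xi> k s"]
      unfolding blinfun.sum_left blinfun.scaleR_left real_scaleR_def mult_1_left .
    moreover have "convergent (\<lambda>n. \<Sum>i<d. (\<Sum>k<n. \<gamma> (Suc k) * (1 * blinfun_apply (\<xi> k s) (b i))) *\<^sub>R e i)"
    proof (rule convergent_sum)
      fix i
      obtain l where "(\<lambda>n. \<Sum>k<n. \<gamma> (Suc k) * (1 * blinfun_apply (\<xi> k s) (b i))) \<longlonglongrightarrow> l"
        using elim(2) unfolding convergent_def by blast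
      hence "(\<lambda>n. (\<Sum>k<n. \<gamma> (Suc k) * (1 * blinfun_apply (\<xi> k s) (b i))) *\<^sub>R e i) \<longlonglongrightarrow> l *\<^sub>R e i"
        by (intro tendsto_intros)
      thus "convergent (\<lambda>n. (\<Sum>k<n. \<gamma> (Suc k) * (1 * blinfun_apply (\<xi> k s) (b i))) *\<^sub>R e i)"
        unfolding convergent_def by blast
    qed
    ultimately have 2: "Bseq (\<lambda>n. \<Sum>k<n. \<gamma> (Suc k) *\<^sub>R \<xi> k s)"
      by (simp only: convergent_imp_Bseq)
    have 3: "summable (\<lambda>n. (\<gamma> (Suc n))\<^sup>2 * (norm (sample_grad n s))\<^sup>2)"
    proof (rule summable_comparison_test')
      show "summable (\<lambda>n. \<Sum>i<d. (\<gamma> (Suc n))\<^sup>2 * (blinfun_apply (sample_grad n s) (b i))\<^sup>2 * (real d * (norm (e i))\<^sup>2))"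
        using elim(3) by (intro summable_sum summable_mult2) blast
      fix n
      have "norm (sample_grad n s) \<le> (\<Sum>i<d. \<bar>blinfun_apply (sample_grad n s) (b i)\<bar> * norm (e i))"
        using arg_cong[OF expand[of "sample_grad n s"], of norm]
          norm_sum[of "\<lambda>i. blinfun_apply (sample_grad n s) (b i) *\<^sub>R e i" "{..<d}"]
        unfolding norm_scaleR by linarith
      hence "(norm (sample_grad n s))\<^sup>2 \<le> (\<Sum>i<d. \<bar>blinfun_apply (sample_grad n s) (b i)\<bar> * norm (e i))\<^sup>2"
        by (intro power_mono) auto
      \<comment> \<open>Cauchy-Schwarz over the \<open>d\<close> coordinates is the source of the
        factor \<open>real d\<close> in the comparison series.\<close>
      also have "\<dots> \<le> (\<Sum>i<d. (\<bar>blinfun_apply (sample_grad n s) (b i)\<bar> * norm (e i))\<^sup>2) * real (card {..<d})"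
        by (rule sum_squared_le_sum_of_squares)
      also have "\<dots> = (\<Sum>i<d. (blinfun_apply (sample_grad n s) (b i))\<^sup>2 * (real d * (norm (e i))\<^sup>2))"
        by (simp add: power_mult_distrib sum_distrib_left mult_ac)
      finally have "(\<gamma> (Suc n))\<^sup>2 * (norm (sample_grad n s))\<^sup>2
          \<le> (\<gamma> (Suc n))\<^sup>2 * (\<Sum>i<d. (blinfun_apply (sample_grad n s) (b i))\<^sup>2 * (real d * (norm (e i))\<^sup>2))"
        by (intro mult_left_mono) auto
      thus "norm ((\<gamma> (Suc n))\<^sup>2 * (norm (sample_grad n s))\<^sup>2)
          \<le> (\<Sum>i<d. (\<gamma> (Suc n))\<^sup>2 * (blinfun_apply (sample_grad n s) (b i))\<^sup>2 * (real d * (norm (e i))\<^sup>2))"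
        by (simp add: sum_distrib_left mult.assoc)
    qed
    show ?case using 1 2 3 by (simp add: \<xi>_def)
  qed
qed

end

section \<open>Finite-time convergence\<close>

theorem theorem6p4:
  fixes C :: "'v::real_normed_vector set"
    and P :: "'w measure"
    and F :: "'v \<Rightarrow> 'w \<Rightarrow> real"
    and gradF :: "'v \<Rightarrow> 'w \<Rightarrow> ('v \<Rightarrow>\<^sub>L real)"
    and f :: "'v \<Rightarrow> real"
    and h :: "'v \<Rightarrow> real"
    and V :: real
    and xstar :: 'v
    and M :: "'s measure"
    and \<omega> :: "nat \<Rightarrow> 's \<Rightarrow> 'w"
    and \<gamma> :: "nat \<Rightarrow> real"
    and y1 :: "'v \<Rightarrow>\<^sub>L real"
    and X :: "nat \<Rightarrow> 's \<Rightarrow> 'v"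
    and Y :: "nat \<Rightarrow> 's \<Rightarrow> ('v \<Rightarrow>\<^sub>L real)"
  assumes "finite_dim TYPE('v)"
    and "C \<noteq> {}" and "compact C" and "convex C"
    and "prob_space P" and "complete_measure P"
    and F_integrable: "\<And>x. x \<in> C \<Longrightarrow> integrable P (F x)"
    and f_def: "\<And>x. f x = (\<integral>w. F x w \<partial>P)"
    and gradF_measurable: "\<And>x. x \<in> C \<Longrightarrow> gradF x \<in> borel_measurable P"
    and coherent: "variationally_coherent C f"
    and i: "AE w in P. C1_with_gradient_on C (\<lambda>x. F x w) (\<lambda>x. gradF x w)"
    and ii: "V \<ge> 0"
            "\<And>x. x \<in> C \<Longrightarrow> integrable P (\<lambda>w. (norm (gradF x w))\<^sup>2) \<and>
                           (\<integral>w. (norm (gradF x w))\<^sup>2 \<partial>P) \<le> V\<^sup>2"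
    and reg: "regularizer C h"
    and iii: "\<And>p y. p \<in> C \<Longrightarrow> (\<lambda>n. mirror_map C h (y n)) \<longlonglongrightarrow> p
                \<Longrightarrow> (\<lambda>n. fenchel_coupling C h p (y n)) \<longlonglongrightarrow> 0"
    and sharp: "sharp_minimum C f xstar"
    and surjective: "range (mirror_map C h) = C"
    and "prob_space M"
    and indep: "prob_space.indep_vars M (\<lambda>_. P) \<omega> {1..}"
    and distributed: "\<And>n. n \<ge> 1 \<Longrightarrow> distr M P (\<omega> n) = P"
    and step_pos: "\<And>n. n \<ge> 1 \<Longrightarrow> \<gamma> n > 0"
    and step_l2: "summable (\<lambda>n. (\<gamma> n)\<^sup>2)"
    and step_l1: "filterlim (\<lambda>N. \<Sum>n=1..N. \<gamma> n) at_top sequentially"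
    and init: "\<And>s. s \<in> space M \<Longrightarrow> Y 1 s = y1"
    and X_eq: "\<And>n s. n \<ge> 1 \<Longrightarrow> s \<in> space M \<Longrightarrow> X n s = mirror_map C h (Y n s)"
    and Y_step: "\<And>n s. n \<ge> 1 \<Longrightarrow> s \<in> space M \<Longrightarrow>
                   Y (Suc n) s = Y n s - \<gamma> n *\<^sub>R gradF (X n s) (\<omega> n s)"
  shows "AE s in M. \<forall>\<^sub>F n in sequentially. X n s = xstar"
proof -
  interpret M: prob_space M by fact
  interpret stochastic_objective P C F gradF f V
    using assms by (intro stochastic_objective.intro stochastic_objective_axioms.intro) auto
  obtain K where K: "K > 0" "strongly_convex_on K C h" and contH: "continuous_on C h"
    using reg by (auto simp: regularizer_def)
  note mirror = \<open>compact C\<close> \<open>C \<noteq> {}\<close> \<open>convex C\<close> contH K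
  interpret stochastic_gradient_process P C F gradF f V M "mirror_map C h" \<gamma> y1 \<omega>
  proof unfold_locales
    show "continuous_on UNIV (mirror_map C h)" by (rule continuous_on_mirror_map[OF mirror])
    show "mirror_map C h y \<in> C" for y by (rule mirror_map_in[OF mirror])
  qed (use indep distributed step_l2 in auto)
  have xs: "xstar \<in> C" using sharp by (simp add: sharp_minimum_def)
  have step_sum: "filterlim (\<lambda>n. \<Sum>k<n. \<gamma> (Suc k)) at_top sequentially"
    using step_l1 by (simp add: sum.atLeast1_atMost_eq)
  \<comment> \<open>Each sample has law \<open>P\<close>, so almost surely none of the countably
    many hits the null set. On such a path the modified and the given gradients agree at all points
    simultaneously.\<close>
  have regular_samples: "AE s in M. \<forall>n. \<omega> (Suc n) s \<notin> exceptional"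
    unfolding AE_all_countable
  proof
    fix n
    have "AE w in distr M P (\<omega> (Suc n)). w \<notin> exceptional"
      by (subst distributed) (simp_all add: AE_not_in[OF exceptional_null])
    moreover have "\<omega> (Suc n) \<in> M \<rightarrow>\<^sub>M P" by (rule \<omega>_measurable) simp
    ultimately show "AE s in M. \<omega> (Suc n) s \<notin> exceptional" by (rule AE_distrD[rotated])
  qed
  show ?thesis
    using regular_samples noise_regular[of xstar] AE_space
  proof eventually_elim
    case (elim s)
    have step: "Y (Suc (Suc n)) s = Y (Suc n) s - \<gamma> (Suc n) *\<^sub>R gradF (X (Suc n) s) (\<omega> (Suc n) s)" for n
      using Y_step[of "Suc n" s] elim(3) by simp
    have X: "X (Suc n) s = mirror_map C h (Y (Suc n) s)" for n
      using X_eq[of "Suc n" s] elim(3) by simp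
    have grad: "gradF x (\<omega> (Suc n) s) = regular_grad x (\<omega> (Suc n) s)" for x n
      using elim(1) by (simp add: regular_grad_def)
    \<comment> \<open>The process starts at index 1 and \<open>state\<close> at 0; both use sample
      \<open>Suc n\<close> in the corresponding step.\<close>
    have Y: "Y (Suc n) s = state n (\<lambda>i. \<omega> i s)" for n
    proof (induction n)
      case 0
      show ?case using init[of s] elim(3) by simp
    next
      case (Suc n)
      thus ?case by (simp add: step X grad)
    qed
    have "\<forall>\<^sub>F n in sequentially. X (Suc n) s = xstar"
    proof (rule iterates_reach[OF contH K _ coherent sharp surjective _ step_sum X step])
      show "\<gamma> (Suc n) > 0" for n using step_pos by simp
      show "(\<lambda>n. mirror_map C h (y n)) \<longlonglongrightarrow> xstar \<Longrightarrow> (\<lambda>n. fenchel_coupling C h xstar (y n)) \<longlonglongrightarrow> 0" for y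
        by (rule iii[OF xs])
    qed (use elim(2) in \<open>simp_all add: X Y grad\<close>)
    thus ?case by (rule eventually_sequentially_Suc[THEN iffD1])
  qed
qed

end
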